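(* Let $\ell$ be a positive integer, $p$ a prime, $\xi,\eta$ complex numbers, and $A,B,Z,W$ finite multisets of complex numbers with $Z=\{z_1,\dots,z_\ell\}$ and $W=\{w_1,\dots,w_\ell\}$. Let $A=A_1\cup\cdots\cup A_\ell$ and $B=B_1\cup\cdots\cup B_\ell$ be partitions of $A$ and $B$. Let $\epsilon>0$ be arbitrarily small and suppose $\operatorname{Re}(\xi)=\operatorname{Re}(\eta)=2\epsilon$ and $|\operatorname{Re}(\gamma)|\le\epsilon$ for all $\gamma\in A\cup B\cup Z\cup W$. Then \[ \sum_{\substack{M_1+\cdots+M_\ell=N_1+\cdots+N_\ell\\ \min\{M_j,N_j\}=0\ \forall j}}\prod_{j=1}^{\ell}\Bigg\{p^{N_j(-\frac12+\xi-z_j)+M_j(-\frac12+\eta-w_j)}\sum_{d=0}^{\infty}\sum_{q=0}^{1}(-1)^q p^{\min\{q+d,N_j\}(1+z_j)+\min\{q+d,M_j\}(1+w_j)-q(2+z_j+w_j)-d(1+\xi+\eta)}\, G_{A_j}\big(1+z_j,p^{q+d-\min\{q+d,N_j\}}\big)\,G_{B_j}\big(1+w_j,p^{q+d-\min\{q+d,M_j\}}\big)\Bigg\} \] \[ =\Big(1-\frac1p\Big)^{-2\ell}\prod_{j=1}^{\ell}\Bigg\{\Big(1-\frac{1}{p^{1+w_j+z_j-\xi-\eta}}\Big)\prod_{\alpha\in A_j}\Big(1-\frac{1}{p^{1+z_j+\alpha}}\Big)\prod_{\beta\in B_j}\Big(1-\frac{1}{p^{1+w_j+\beta}}\Big)\Bigg\}\sum_{m=0}^{\infty}\frac{I_{A_{\xi+\eta}\cup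 W,(Z^-)_{\xi+\eta}}(p^m)\,I_{B\cup Z_{-\xi-\eta},W^-}(p^m)}{p^m}, \] where the sum on the left is over nonnegative integers $M_1,\dots,M_\ell,N_1,\dots,N_\ell$.
   Context: Multisets are counted with multiplicity. For a multiset $E$ and complex $s$, $E_s:=\{\gamma+s:\gamma\in E\}$ and $E^-:=\{-\gamma:\gamma\in E\}$. For a finite multiset $E$, $\tau_E$ is defined by $\sum_{m\ge1}\tau_E(m)m^{-s}=\prod_{\gamma\in E}\zeta(s+\gamma)$. For finite multisets $C=\{\gamma_1,\dots,\gamma_h\}$, $D=\{\delta_1,\dots,\delta_k\}$, $I_{C,D}(m)=\sum_{m_1\cdots m_h n_1\cdots n_k=m} m_1^{-\gamma_1}\cdots m_h^{-\gamma_h}\mu(n_1)n_1^{-\delta_1}\cdots\mu(n_k)n_k^{-\delta_k}$, the Dirichlet coefficients of $\prod_{\gamma\in C}\zeta(s+\gamma)/\prod_{\delta\in D}\zeta(s+\delta)$. Define $g_E(s,n)=\prod_{p\mid n}\{\prod_{\gamma\in E}(1-p^{-s-\gamma})\}\sum_{m=0}^{\infty}\tau_E(p^{m+\operatorname{ord}_p(n)})p^{-ms}$ and $G_E(s,q)=\sum_{d\mid q}\frac{\mu(d)d^s}{\phi(d)}\sum_{e\mid d}\frac{\mu(e)}{e^s}g_E(s,eq/d)$, with $\mu$ the Möbius function and $\phi$ Euler's totient function. *)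

theory Defs
  imports "HOL-Analysis.Analysis" "HOL-Number_Theory.Totient"
    "HOL-Computational_Algebra.Squarefree" "HOL-Combinatorics.Permutations"
begin

definition mset_shift :: "complex \<Rightarrow> complex multiset \<Rightarrow> complex multiset" where
  "mset_shift s E = image_mset (\<lambda>\<gamma>. \<gamma> + s) E"

definition mset_neg :: "complex multiset \<Rightarrow> complex multiset" where
  "mset_neg E = image_mset uminus E"

definition mobius :: "nat \<Rightarrow> int" where
  "mobius n = (if squarefree n then (-1) ^ card (prime_factors n) else 0)"

text \<open>The Riemann zeta function, meaningful only in the half-plane of absolute convergence
  \<open>Re s > 1\<close>. This suffices for identifying Dirichlet coefficients.\<close>

definition zeta_series :: "complex \<Rightarrow> complex" where
  "zeta_series s = (\<Sum>\<^sub>\<infinity>n\<in>{1..}. of_nat n powr (-s))"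

text \<open>The condition \<open>f 0 = 0\<close> only fixes the irrelevant value at \<open>0\<close>. Existence and uniqueness
  of such an \<open>f\<close> are shown below (\<open>has_sum_tau\<close>, \<open>tau_eqI\<close>).\<close>

definition tau :: "complex multiset \<Rightarrow> nat \<Rightarrow> complex" where
  "tau E = (THE f. f 0 = 0 \<and> (\<exists>\<sigma>. \<forall>s. Re s > \<sigma> \<longrightarrow>
     ((\<lambda>m. f m * of_nat m powr (-s)) has_sum (\<Prod>\<gamma>\<in>#E. zeta_series (s + \<gamma>))) {1..}))"

definition I_list :: "complex list \<Rightarrow> complex list \<Rightarrow> nat \<Rightarrow> complex" where
  "I_list cs ds m =
     (\<Sum>(ms, ns) | length ms = length cs \<and> length ns = length ds \<and> prod_list ms * prod_list ns = m.
        (\<Prod>i<length cs. of_nat (ms ! i) powr (- (cs ! i))) *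
        (\<Prod>i<length ds. of_int (mobius (ns ! i)) * of_nat (ns ! i) powr (- (ds ! i))))"

text \<open>The enumerations of the two multisets are chosen arbitrarily; the value does not depend on
  the choice (\<open>I_coeff_mset\<close> below).\<close>

definition I_coeff :: "complex multiset \<Rightarrow> complex multiset \<Rightarrow> nat \<Rightarrow> complex" where
  "I_coeff C D m = I_list (SOME cs. mset cs = C) (SOME ds. mset ds = D) m"

definition g_fun :: "complex multiset \<Rightarrow> complex \<Rightarrow> nat \<Rightarrow> complex" where
  "g_fun E s n = (\<Prod>p\<in>prime_factors n.
     (\<Prod>\<gamma>\<in>#E. 1 - of_nat p powr (- s - \<gamma>)) *
     (\<Sum>m. tau E (p ^ (m + multiplicity p n)) * of_nat p powr (- (of_nat m * s))))"

definition G_fun :: "complex multiset \<Rightarrow> complex \<Rightarrow> nat \<Rightarrow> complex" where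
  "G_fun E s q = (\<Sum>d | d dvd q. of_int (mobius d) * of_nat d powr s / of_nat (totient d) *
     (\<Sum>e | e dvd d. of_int (mobius e) / of_nat e powr s * g_fun E s (e * q div d)))"

text \<open>\<open>d_term\<close> is the \<open>d\<close>-th summand (including the sum over \<open>q\<close>) of the inner series, and
  \<open>MN_factor\<close> the factor in braces, on the left-hand side of the identity, with the index \<open>j\<close>
  dropped.\<close>

definition d_term :: "nat \<Rightarrow> complex \<Rightarrow> complex \<Rightarrow> complex multiset \<Rightarrow> complex multiset \<Rightarrow>
    complex \<Rightarrow> complex \<Rightarrow> nat \<Rightarrow> nat \<Rightarrow> nat \<Rightarrow> complex" where
  "d_term p \<xi> \<eta> A B z w M N d = (\<Sum>q\<in>{0..1}. (-1) ^ q *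
     of_nat p powr (of_nat (min (q + d) N) * (1 + z) + of_nat (min (q + d) M) * (1 + w)
                    - of_nat q * (2 + z + w) - of_nat d * (1 + \<xi> + \<eta>)) *
     G_fun A (1 + z) (p ^ (q + d - min (q + d) N)) *
     G_fun B (1 + w) (p ^ (q + d - min (q + d) M)))"

definition MN_factor :: "nat \<Rightarrow> complex \<Rightarrow> complex \<Rightarrow> complex multiset \<Rightarrow> complex multiset \<Rightarrow>
    complex \<Rightarrow> complex \<Rightarrow> nat \<Rightarrow> nat \<Rightarrow> complex" where
  "MN_factor p \<xi> \<eta> A B z w M N =
     of_nat p powr (of_nat N * (- 1 / 2 + \<xi> - z) + of_nat M * (- 1 / 2 + \<eta> - w)) *
     (\<Sum>d. d_term p \<xi> \<eta> A B z w M N d)"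

definition MN_index :: "nat \<Rightarrow> ((nat \<Rightarrow> nat) \<times> (nat \<Rightarrow> nat)) set" where
  "MN_index l = {(M, N). M \<in> {1..l} \<rightarrow>\<^sub>E UNIV \<and> N \<in> {1..l} \<rightarrow>\<^sub>E UNIV \<and>
     (\<Sum>j=1..l. M j) = (\<Sum>j=1..l. N j) \<and> (\<forall>j\<in>{1..l}. min (M j) (N j) = 0)}"

lemma I_list_cong_mset:
  assumes "mset cs = mset cs'" "mset ds = mset ds'"
  shows "I_list cs ds m = I_list cs' ds' m"
proof -
  obtain p where p: "p permutes {..<length cs'}" "permute_list p cs' = cs"
    using mset_eq_permutation[OF assms(1)] by blast
  obtain q where q: "q permutes {..<length ds'}" "permute_list q ds' = ds"
    using mset_eq_permutation[OF assms(2)] by blast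
  have len: "length cs = length cs'" "length ds = length ds'"
    using assms by (auto dest: mset_eq_length)
  have inv: "permute_list (inv r) (permute_list r xs) = xs"
            "permute_list r (permute_list (inv r) xs) = xs"
    if "r permutes {..<length xs}" for r and xs :: "nat list"
    using permute_list_compose[of "inv r" xs r] permute_list_compose[of r xs "inv r"] that
    by (simp_all add: permutes_inv permutes_inv_o)
  have pl: "prod_list (permute_list r xs) = prod_list xs"
    if "r permutes {..<length xs}" for r and xs :: "nat list"
    using that by (metis mset_permute_list prod_mset_prod_list)
  have reix: "(\<Prod>i<n. f (permute_list r xs ! i) (permute_list r ys ! i)) = (\<Prod>i<n. f (xs ! i) (ys ! i))"
    if "r permutes {..<n}" "length xs = n" "length ys = n"
    for r n and xs :: "nat list" and ys :: "complex list" and f :: "nat \<Rightarrow> complex \<Rightarrow> complex"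
  proof -
    have "(\<Prod>i<n. f (permute_list r xs ! i) (permute_list r ys ! i)) = (\<Prod>i<n. f (xs ! r i) (ys ! r i))"
      using that by (intro prod.cong) (auto simp: permute_list_nth)
    also have "\<dots> = (\<Prod>i<n. f (xs ! i) (ys ! i))"
      using prod.permute[OF that(1), of "\<lambda>i. f (xs ! i) (ys ! i)"] by (simp add: o_def)
    finally show ?thesis .
  qed
  show ?thesis unfolding I_list_def
  proof (rule sum.reindex_bij_witness[where
      i = "\<lambda>(ms, ns). (permute_list p ms, permute_list q ns)" and
      j = "\<lambda>(ms, ns). (permute_list (inv p) ms, permute_list (inv q) ns)"], goal_cases)
    case (1 a)
    then show ?case using p q len by (auto simp: inv)
  next
    case (2 a)
    then show ?case using p q len by (auto simp: pl permutes_inv)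
  next
    case (3 b)
    then show ?case using p q len by (auto simp: inv)
  next
    case (4 b)
    then show ?case using p q len by (auto simp: pl)
  next
    case (5 a)
    obtain ms ns where a: "a = (ms, ns)" by force
    have l: "length ms = length cs'" "length ns = length ds'" using 5 a len by auto
    have "(\<Prod>i<length cs'. of_nat (permute_list p (permute_list (inv p) ms) ! i) powr - (permute_list p cs' ! i)) =
          (\<Prod>i<length cs'. of_nat (permute_list (inv p) ms ! i) powr - (cs' ! i))"
      by (rule reix[where f = "\<lambda>a c. of_nat a powr (-c)"]) (use p l in auto)
    moreover have "(\<Prod>i<length ds'. of_int (mobius (permute_list q (permute_list (inv q) ns) ! i)) *
              of_nat (permute_list q (permute_list (inv q) ns) ! i) powr - (permute_list q ds' ! i)) =
          (\<Prod>i<length ds'. of_int (mobius (permute_list (inv q) ns ! i)) *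
              of_nat (permute_list (inv q) ns ! i) powr - (ds' ! i))"
      by (rule reix[where f = "\<lambda>a c. of_int (mobius a) * of_nat a powr (-c)"]) (use q l in auto)
    ultimately show ?case
      using p q l a by (simp add: inv len)
  qed
qed

lemma I_coeff_mset: "I_coeff (mset cs) (mset ds) m = I_list cs ds m"
  unfolding I_coeff_def
  by (rule I_list_cong_mset) (rule someI_ex, blast)+

lemma norm_of_nat_powr: "norm (of_nat n powr (s::complex)) = real n powr Re s"
  using norm_powr_real_powr[of "of_nat n" s] by simp

lemma zeta_series_has_sum:
  assumes "Re s > 1"
  shows "(\<lambda>n. norm (of_nat n powr (-s))) summable_on {1::nat..}"
    and "((\<lambda>n. of_nat n powr (-s)) has_sum zeta_series s) {1::nat..}"
proof -
  have "summable (\<lambda>n. norm (of_nat n powr (-s)))"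
    using assms by (simp add: norm_of_nat_powr summable_real_powr_iff)
  then have "(\<lambda>n. norm (of_nat n powr (-s))) summable_on (UNIV::nat set)"
    by (subst summable_on_UNIV_nonneg_real_iff) auto
  then show *: "(\<lambda>n. norm (of_nat n powr (-s))) summable_on {1::nat..}"
    by (rule summable_on_subset_banach) auto
  show "((\<lambda>n. of_nat n powr (-s)) has_sum zeta_series s) {1::nat..}"
    unfolding zeta_series_def using abs_summable_summable[OF *] by (rule has_sum_infsum)
qed

lemma has_sum_lists:
  assumes "\<forall>\<gamma>\<in>set cs. Re (s + \<gamma>) > 1"
  shows "(\<lambda>ms. norm (\<Prod>i<length cs. of_nat (ms ! i) powr (- (s + cs ! i)))) summable_on
           {ms::nat list. length ms = length cs \<and> 0 \<notin> set ms} \<and>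
         ((\<lambda>ms. \<Prod>i<length cs. of_nat (ms ! i) powr (- (s + cs ! i))) has_sum
           (\<Prod>\<gamma>\<in>#mset cs. zeta_series (s + \<gamma>))) {ms::nat list. length ms = length cs \<and> 0 \<notin> set ms}"
  using assms
proof (induction cs)
  case Nil
  have eq: "{ms::nat list. length ms = length [] \<and> 0 \<notin> set ms} = {[]}" by auto
  show ?case unfolding eq using has_sum_finite[of "{[]::nat list}" "\<lambda>_. 1::complex"] by simp
next
  case (Cons c cs)
  define T where "T = {ms::nat list. length ms = length cs \<and> 0 \<notin> set ms}"
  define F :: "nat list \<Rightarrow> complex" where "F ms = (\<Prod>i<length cs. of_nat (ms ! i) powr (- (s + cs ! i)))" for ms
  define h :: "nat \<Rightarrow> complex" where "h n = of_nat n powr (- (s + c))" for n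
  have h: "(\<lambda>n. norm (h n)) summable_on {1..}" "(h has_sum zeta_series (s + c)) {1..}"
    unfolding h_def using zeta_series_has_sum[of "s + c"] Cons.prems by auto
  have F: "(\<lambda>ms. norm (F ms)) summable_on T"
          "(F has_sum (\<Prod>\<gamma>\<in>#mset cs. zeta_series (s + \<gamma>))) T"
    using Cons unfolding F_def T_def by auto
  have S: "(\<lambda>(n, ms). norm (h n * F ms)) summable_on {1..} \<times> T"
    using h(1) F(1)
    by (intro summable_on_SigmaI[where g = "\<lambda>n. norm (h n) * infsum (\<lambda>ms. norm (F ms)) T"])
       (auto simp: norm_mult intro!: has_sum_cmult_right summable_on_cmult_left has_sum_infsum)
  have H: "((\<lambda>(n, ms). h n * F ms) has_sum (zeta_series (s + c) * (\<Prod>\<gamma>\<in>#mset cs. zeta_series (s + \<gamma>)))) ({1..} \<times> T)"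
  proof (rule has_sum_SigmaI)
    show "((\<lambda>y. case (x, y) of (n, ms) \<Rightarrow> h n * F ms) has_sum (h x * (\<Prod>\<gamma>\<in>#mset cs. zeta_series (s + \<gamma>)))) T" for x
      using F(2) by (auto intro: has_sum_cmult_right)
    show "((\<lambda>x. h x * (\<Prod>\<gamma>\<in>#mset cs. zeta_series (s + \<gamma>))) has_sum
           (zeta_series (s + c) * (\<Prod>\<gamma>\<in>#mset cs. zeta_series (s + \<gamma>)))) {1..}"
      using h(2) by (rule has_sum_cmult_left)
    show "(\<lambda>(n, ms). h n * F ms) summable_on {1..} \<times> T"
      by (rule abs_summable_summable) (use S in \<open>simp add: case_prod_unfold\<close>)
  qed
  have bij: "bij_betw (\<lambda>(n, ms). n # ms) ({1..} \<times> T) {ms::nat list. length ms = length (c # cs) \<and> 0 \<notin> set ms}"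
    by (rule bij_betwI[where g = "\<lambda>ms. (hd ms, tl ms)"])
       (auto simp: T_def length_Suc_conv)
  have val: "(\<Prod>i<length (c # cs). of_nat ((n # ms) ! i) powr (- (s + (c # cs) ! i))) = h n * F ms" for n ms
    unfolding length_Cons prod.lessThan_Suc_shift h_def F_def by simp
  show ?case
  proof
    show "(\<lambda>ms. norm (\<Prod>i<length (c # cs). of_nat (ms ! i) powr (- (s + (c # cs) ! i)))) summable_on
           {ms::nat list. length ms = length (c # cs) \<and> 0 \<notin> set ms}"
      by (subst summable_on_reindex_bij_betw[OF bij, symmetric])
         (use S in \<open>simp only: case_prod_unfold val\<close>)
    show "((\<lambda>ms. \<Prod>i<length (c # cs). of_nat (ms ! i) powr (- (s + (c # cs) ! i))) has_sum
           (\<Prod>\<gamma>\<in>#mset (c # cs). zeta_series (s + \<gamma>))) {ms::nat list. length ms = length (c # cs) \<and> 0 \<notin> set ms}"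
      by (subst has_sum_reindex_bij_betw[OF bij, symmetric])
         (use H in \<open>simp only: case_prod_unfold val mset.simps image_mset_add_mset prod_mset.add_mset\<close>)
  qed
qed

lemma prod_of_nat_powr:
  "(\<Prod>i<length ms. of_nat (ms ! i) powr (s::complex)) = of_nat (prod_list ms) powr s"
proof (induction ms)
  case (Cons n ms)
  then show ?case
    unfolding length_Cons prod.lessThan_Suc_shift
    by (simp add: powr_times_real[symmetric])
qed simp

lemma finite_fixed_prod: "m > 0 \<Longrightarrow> finite {ms::nat list. length ms = k \<and> prod_list ms = m}"
proof (rule finite_subset)
  assume "m > 0"
  show "{ms::nat list. length ms = k \<and> prod_list ms = m} \<subseteq> {ms. set ms \<subseteq> {..m} \<and> length ms = k}"
  proof safe
    fix ms :: "nat list" and x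
    assume "x \<in> set ms" "m = prod_list ms"
    then have "x dvd m" by (auto simp: in_set_conv_decomp)
    then show "x \<le> prod_list ms" using \<open>m > 0\<close> \<open>m = prod_list ms\<close> by (auto intro: dvd_imp_le)
  qed
qed (rule finite_lists_length_eq, simp)

lemma has_sum_I_list:
  assumes "\<forall>\<gamma>\<in>set cs. Re (s + \<gamma>) > 1"
  shows "((\<lambda>m. I_list cs [] m * of_nat m powr (-s)) has_sum (\<Prod>\<gamma>\<in>#mset cs. zeta_series (s + \<gamma>))) {1..}"
proof -
  define T where "T m = {ms::nat list. length ms = length cs \<and> prod_list ms = m}" for m
  define F :: "nat list \<Rightarrow> complex" where "F ms = (\<Prod>i<length cs. of_nat (ms ! i) powr (- (s + cs ! i)))" for ms
  have bij: "bij_betw snd (Sigma {1..} T) {ms::nat list. length ms = length cs \<and> 0 \<notin> set ms}"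
    by (rule bij_betwI[where g = "\<lambda>ms. (prod_list ms, ms)"])
       (auto simp: T_def prod_list_zero_iff Suc_le_eq in_set_conv_decomp intro!: Nat.gr0I)
  have "(F has_sum (\<Prod>\<gamma>\<in>#mset cs. zeta_series (s + \<gamma>))) {ms::nat list. length ms = length cs \<and> 0 \<notin> set ms}"
    using has_sum_lists[OF assms] unfolding F_def by blast
  then have "((\<lambda>x. F (snd x)) has_sum (\<Prod>\<gamma>\<in>#mset cs. zeta_series (s + \<gamma>))) (Sigma {1..} T)"
    by (subst has_sum_reindex_bij_betw[OF bij])
  then show ?thesis
  proof (rule has_sum_SigmaD)
    fix m :: nat assume m: "m \<in> {1..}"
    have fin: "finite (T m)" using m finite_fixed_prod[of m "length cs"] by (simp add: T_def)
    have "I_list cs [] m = (\<Sum>ms\<in>T m. \<Prod>i<length cs. of_nat (ms ! i) powr (- (cs ! i)))"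
      unfolding I_list_def T_def
      by (rule sum.reindex_bij_witness[where i = "\<lambda>ms. (ms, [])" and j = fst]) auto
    moreover have "F ms = (\<Prod>i<length cs. of_nat (ms ! i) powr (- (cs ! i))) * of_nat m powr (-s)"
      if "ms \<in> T m" for ms
    proof -
      have l: "length cs = length ms" "prod_list ms = m" using that by (auto simp: T_def)
      have "F ms = (\<Prod>i<length cs. of_nat (ms ! i) powr (- (cs ! i)) * of_nat (ms ! i) powr (- s))"
        unfolding F_def by (intro prod.cong refl) (simp flip: powr_add add: add.commute)
      also have "\<dots> = (\<Prod>i<length cs. of_nat (ms ! i) powr (- (cs ! i))) * of_nat m powr (-s)"
        using prod_of_nat_powr[of ms "-s"] l by (simp add: prod.distrib)
      finally show ?thesis .
    qed
    ultimately have "I_list cs [] m * of_nat m powr (-s) = sum F (T m)"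
      by (simp add: sum_distrib_right)
    then show "((\<lambda>y. F (snd (m, y))) has_sum I_list cs [] m * of_nat m powr (-s)) (T m)"
      using has_sum_finite[OF fin, of F] by simp
  qed
qed

lemma dirichlet_series_unique:
  fixes f :: "nat \<Rightarrow> complex"
  assumes "\<And>s. Re s > \<sigma> \<Longrightarrow> ((\<lambda>m. f m * of_nat m powr (-s)) has_sum 0) {1..}"
  assumes "n \<ge> 1"
  shows "f n = 0"
  using \<open>n \<ge> 1\<close>
proof (induction n rule: less_induct)
  case (less n)
  define a :: real where "a = \<sigma> + 1"
  define b :: "nat \<Rightarrow> real" where "b m = norm (f m * of_nat m powr (- of_real a))" for m
  have b: "b summable_on {1..}"
    unfolding b_def
    using assms(1)[of "of_real a"] by (auto simp: a_def summable_on_iff_abs_summable_on_complex dest: has_sum_imp_summable)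
  then have b': "b summable_on {Suc n..}"
    by (rule summable_on_subset_banach) auto
  define K where "K = real n powr a * infsum b {Suc n..}"
  have bound: "norm (f n) \<le> K * (real n / real (Suc n)) ^ k" for k
  proof -
    define s :: complex where "s = of_real (a + real k)"
    have "((\<lambda>m. f m * of_nat m powr (-s)) has_sum 0) {1..}"
      by (rule assms(1)) (simp add: s_def a_def)
    then have "((\<lambda>m. f m * of_nat m powr (-s)) has_sum 0) {n..}"
      by (rule has_sum_cong_neutral[THEN iffD1, rotated -1]) (use less in auto)
    then have "((\<lambda>m. f m * of_nat m powr (-s)) has_sum (0 - f n * of_nat n powr (-s))) ({n..} - {n})"
      by (rule has_sum_Diff) (auto intro!: has_sum_finiteI)
    moreover have "{n..} - {n} = {Suc n..}" by auto
    ultimately have 1: "((\<lambda>m. f m * of_nat m powr (-s)) has_sum (- (f n * of_nat n powr (-s)))) {Suc n..}"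
      by simp
    have 2: "norm (f m * of_nat m powr (-s)) \<le> b m * real (Suc n) powr (- real k)"
      if "m \<in> {Suc n..}" for m
    proof -
      have "norm (f m * of_nat m powr (-s)) = norm (f m) * real m powr (- a) * real m powr (- real k)"
        by (simp add: s_def norm_mult norm_of_nat_powr powr_add[symmetric])
      also have "\<dots> \<le> norm (f m) * real m powr (- a) * real (Suc n) powr (- real k)"
        using that by (intro mult_left_mono powr_mono2') auto
      finally show ?thesis by (simp add: b_def norm_mult norm_of_nat_powr)
    qed
    have 3: "(\<lambda>m. norm (f m * of_nat m powr (-s))) summable_on {Suc n..}"
      using has_sum_imp_summable[OF 1] by (rule summable_on_iff_abs_summable_on_complex[THEN iffD1])
    have "norm (- (f n * of_nat n powr (-s))) \<le> (\<Sum>\<^sub>\<infinity>m\<in>{Suc n..}. norm (f m * of_nat m powr (-s)))"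
      using norm_infsum_bound[OF 3] infsumI[OF 1] by simp
    also have "\<dots> \<le> (\<Sum>\<^sub>\<infinity>m\<in>{Suc n..}. b m * real (Suc n) powr (- real k))"
      using 2 3 b' by (intro infsum_mono summable_on_cmult_left) auto
    also have "\<dots> = infsum b {Suc n..} * real (Suc n) powr (- real k)"
      using b' by (intro infsum_cmult_left) auto
    finally have "norm (- (f n * of_nat n powr (-s))) \<le> infsum b {Suc n..} * real (Suc n) powr (- real k)" .
    then have "norm (f n) * real n powr (- (a + real k)) \<le> infsum b {Suc n..} * real (Suc n) powr (- real k)"
      by (simp add: norm_mult norm_of_nat_powr s_def)
    then have "norm (f n) * real n powr (- (a + real k)) * real n powr (a + real k) \<le>
        infsum b {Suc n..} * real (Suc n) powr (- real k) * real n powr (a + real k)"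
      by (intro mult_right_mono) auto
    moreover have "real n powr (- (a + real k)) * real n powr (a + real k) = 1"
      using less.prems by (simp add: powr_add[symmetric])
    moreover have "real (Suc n) powr (- real k) * real n powr (a + real k) = real n powr a * (real n / real (Suc n)) ^ k"
    proof -
      have "real n powr (a + real k) = real n powr a * real n ^ k"
        using less.prems by (simp add: powr_add powr_realpow)
      moreover have "real (Suc n) powr (- real k) = inverse (real (Suc n) ^ k)"
        by (simp add: powr_minus powr_realpow del: of_nat_Suc)
      ultimately show ?thesis
        by (simp only: divide_inverse power_mult_distrib power_inverse mult_ac)
    qed
    ultimately show ?thesis unfolding K_def by (simp only: mult.assoc mult_1_right mult.commute mult.left_commute)
  qed
  have "(\<lambda>k. K * (real n / real (Suc n)) ^ k) \<longlonglongrightarrow> K * 0"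
    by (intro tendsto_mult tendsto_const LIMSEQ_realpow_zero) auto
  then have "norm (f n) \<le> K * 0"
    using bound by (intro LIMSEQ_le_const) auto
  then show ?case by simp
qed

lemma tau_eqI:
  assumes "f 0 = 0"
  assumes "\<And>s. Re s > \<sigma> \<Longrightarrow>
    ((\<lambda>m. f m * of_nat m powr (-s)) has_sum (\<Prod>\<gamma>\<in>#E. zeta_series (s + \<gamma>))) {1..}"
  shows "tau E = f"
  unfolding tau_def
proof (rule the_equality)
  show "f 0 = 0 \<and> (\<exists>\<sigma>. \<forall>s. Re s > \<sigma> \<longrightarrow>
     ((\<lambda>m. f m * of_nat m powr (-s)) has_sum (\<Prod>\<gamma>\<in>#E. zeta_series (s + \<gamma>))) {1..})"
    using assms by blast
next
  fix g assume g: "g 0 = 0 \<and> (\<exists>\<sigma>. \<forall>s. Re s > \<sigma> \<longrightarrow>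
     ((\<lambda>m. g m * of_nat m powr (-s)) has_sum (\<Prod>\<gamma>\<in>#E. zeta_series (s + \<gamma>))) {1..})"
  then obtain \<sigma>' where \<sigma>': "\<And>s. Re s > \<sigma>' \<Longrightarrow>
     ((\<lambda>m. g m * of_nat m powr (-s)) has_sum (\<Prod>\<gamma>\<in>#E. zeta_series (s + \<gamma>))) {1..}" by blast
  have "g n - f n = 0" if "n \<ge> 1" for n
  proof (rule dirichlet_series_unique[where \<sigma> = "max \<sigma> \<sigma>'", OF _ that])
    fix s assume "Re s > max \<sigma> \<sigma>'"
    then show "((\<lambda>m. (g m - f m) * of_nat m powr (-s)) has_sum 0) {1..}"
      using has_sum_add[OF \<sigma>'[of s] has_sum_uminusI[OF assms(2)[of s]]] by (simp add: algebra_simps)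
  qed
  then show "g = f" using g assms(1) by (intro ext) (metis eq_iff_diff_eq_0 less_one not_le)
qed

lemma tau_conv_I_list:
  assumes "m > 0"
  shows "tau (mset cs) m = I_list cs [] m"
proof -
  define \<sigma> where "\<sigma> = 1 + (\<Sum>c\<leftarrow>cs. \<bar>Re c\<bar>)"
  have le: "\<bar>Re c\<bar> \<le> (\<Sum>c\<leftarrow>cs. \<bar>Re c\<bar>)" if "c \<in> set cs" for c
    using that by (intro member_le_sum_list) auto
  have "tau (mset cs) = (\<lambda>m. if m = 0 then 0 else I_list cs [] m)"
  proof (rule tau_eqI[where \<sigma> = \<sigma>])
    fix s assume "Re s > \<sigma>"
    then have "\<forall>\<gamma>\<in>set cs. Re (s + \<gamma>) > 1" using le by (fastforce simp: \<sigma>_def)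
    from has_sum_I_list[OF this]
    show "((\<lambda>m. (if m = 0 then 0 else I_list cs [] m) * of_nat m powr (-s)) has_sum
            (\<Prod>\<gamma>\<in>#mset cs. zeta_series (s + \<gamma>))) {1..}"
      by (rule has_sum_cong[THEN iffD1, rotated]) auto
  qed auto
  then show ?thesis using assms by simp
qed

lemma tau_conv_I_coeff: "m > 0 \<Longrightarrow> tau E m = I_coeff E {#} m"
  using tau_conv_I_list[of m] I_coeff_mset[of _ "[]"] by (metis ex_mset mset.simps(1))

lemma has_sum_tau:
  assumes "\<forall>\<gamma>\<in>#E. Re (s + \<gamma>) > 1"
  shows "((\<lambda>m. tau E m * of_nat m powr (-s)) has_sum (\<Prod>\<gamma>\<in>#E. zeta_series (s + \<gamma>))) {1..}"
proof -
  obtain cs where E: "E = mset cs" by (metis ex_mset)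
  have "((\<lambda>m. I_list cs [] m * of_nat m powr (-s)) has_sum (\<Prod>\<gamma>\<in>#E. zeta_series (s + \<gamma>))) {1..}"
    unfolding E using assms by (intro has_sum_I_list) (auto simp: E)
  then show ?thesis
    by (rule has_sum_cong[THEN iffD1, rotated]) (auto simp: E tau_conv_I_list)
qed

end

theory Submission
  imports Defs
begin

text \<open>
  Fix \<open>p\<close> and drop the index \<open>j\<close>. Let \<open>a\<^sub>m = I_coeff A {#-z#} (p ^ m)\<close>,
  \<open>b\<^sub>n = I_coeff B {#-w#} (p ^ n)\<close>, \<open>x = p powr (-1 - z)\<close>, \<open>y = p powr (-1 - w)\<close> and
  \<open>v = p powr (1 + z + w - \<xi> - \<eta>)\<close>. Up to an Euler factor and \<open>1 - 1/p\<close>,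
  \<open>G_fun A (1 + z) (p ^ r)\<close> is \<open>x\<close> to the power \<open>-r\<close> times the tail \<open>\<Sum>m\<ge>r. a\<^sub>m x\<^sup>m\<close>, so the sum
  over \<open>q\<close> telescopes and \<open>MN_factor\<close> becomes \<open>\<Sum>m n. a\<^sub>m b\<^sub>n x\<^sup>m y\<^sup>n v ^ min (m + N) (n + M)\<close>.

  On the right-hand side the Dirichlet coefficients at powers of \<open>p\<close> are the coefficients of
  \<open>\<Prod>j. F j\<close> and \<open>\<Prod>j. E j\<close> for explicit rational power series, and the sum runs over all
  exponents \<open>r\<^sub>j, s\<^sub>j\<close> with equal totals. Writing \<open>r = M + i\<close>, \<open>s = N + i\<close> with \<open>min M N = 0\<close> and
  summing over \<open>i\<close> gives a geometric series of ratio \<open>1/v\<close>, which accounts for the factor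
  \<open>1 - 1/v\<close>, and leaves the same kernel in \<open>m\<close> and \<open>n\<close> up to \<open>p powr (\<eta> * (M - N))\<close>. These
  powers cancel in the product over \<open>j\<close>.
\<close>

unbundle no vec_syntax
unbundle fps_syntax

no_notation Infinite_Set_Sum.abs_summable_on (infix "abs'_summable'_on" 50)

section \<open>Absolutely convergent sums\<close>

lemma abs_summable_on_times:
  fixes f :: "'a \<Rightarrow> 'c :: {banach, real_normed_div_algebra}"
  assumes "f abs_summable_on A" "g abs_summable_on B"
  shows "(\<lambda>(x, y). f x * g y) abs_summable_on A \<times> B"
proof -
  have "(\<lambda>(x, y). norm (f x) * norm (g y)) summable_on A \<times> B"
    using assms
    by (intro summable_on_SigmaI[where g = "\<lambda>x. norm (f x) * infsum (\<lambda>y. norm (g y)) B"])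
       (auto intro!: has_sum_cmult_right summable_on_cmult_left has_sum_infsum)
  then show ?thesis by (simp add: case_prod_unfold norm_mult)
qed

lemma has_sum_times:
  fixes f :: "'a \<Rightarrow> 'c :: {banach, real_normed_div_algebra}"
  assumes "f abs_summable_on A" "g abs_summable_on B"
    and "(f has_sum a) A" "(g has_sum b) B"
  shows "((\<lambda>(x, y). f x * g y) has_sum (a * b)) (A \<times> B)"
proof (rule has_sum_SigmaI[where g = "\<lambda>x. f x * b"])
  show "(\<lambda>(x, y). f x * g y) summable_on A \<times> B"
    using abs_summable_on_times[OF assms(1,2)] by (rule abs_summable_summable)
qed (use assms in \<open>auto intro: has_sum_cmult_right has_sum_cmult_left\<close>)

text \<open>Splitting off one coordinate turns \<open>PiE (insert x J) B\<close> into a product of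
  two index sets, where \<open>has_sum_times\<close> applies. Absolute summability is proved along
  with the value because the product rule needs it at every stage of the induction.\<close>

lemma prod_PiE_abs_summable_has_sum:
  fixes f :: "'a \<Rightarrow> 'b \<Rightarrow> 'c :: {banach, real_normed_field}"
  assumes "finite J" "\<And>j. j \<in> J \<Longrightarrow> f j abs_summable_on B j"
  shows "(\<lambda>g. \<Prod>j\<in>J. f j (g j)) abs_summable_on PiE J B \<and>
         ((\<lambda>g. \<Prod>j\<in>J. f j (g j)) has_sum (\<Prod>j\<in>J. infsum (f j) (B j))) (PiE J B)"
  using assms
proof (induction J)
  case empty
  then show ?case using has_sum_finite[of "{\<lambda>x. undefined}" "\<lambda>_. 1::'c"] by simp
next
  case (insert x J)
  let ?F = "\<lambda>J g. \<Prod>j\<in>J. f j (g j)"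
  have bij: "bij_betw (\<lambda>(y, g). g(x := y)) (B x \<times> PiE J B) (PiE (insert x J) B)"
    unfolding bij_betw_def using inj_combinator[OF insert.hyps(2)] by (auto simp: PiE_insert_eq)
  have val: "?F (insert x J) (g(x := y)) = f x y * ?F J g" for g y
  proof -
    have "(\<Prod>j\<in>J. f j ((g(x := y)) j)) = ?F J g"
      using insert.hyps by (intro prod.cong) auto
    then show ?thesis using insert.hyps by simp
  qed
  have IH: "?F J abs_summable_on PiE J B" "(?F J has_sum (\<Prod>j\<in>J. infsum (f j) (B j))) (PiE J B)"
    using insert.IH insert.prems by blast+
  have fx: "f x abs_summable_on B x" using insert.prems by auto
  then have fx': "(f x has_sum infsum (f x) (B x)) (B x)"
    by (rule has_sum_infsum[OF abs_summable_summable])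
  have "(\<lambda>(y, g). norm (f x y * ?F J g)) summable_on (B x \<times> PiE J B)"
    using abs_summable_on_times[OF fx IH(1)] by (simp add: case_prod_unfold)
  then have 1: "?F (insert x J) abs_summable_on PiE (insert x J) B"
    by (subst summable_on_reindex_bij_betw[OF bij, symmetric]) (simp only: case_prod_unfold val)
  have "((\<lambda>(y, g). f x y * ?F J g) has_sum (\<Prod>j\<in>insert x J. infsum (f j) (B j))) (B x \<times> PiE J B)"
    using has_sum_times[OF fx IH(1) fx' IH(2)] insert.hyps by simp
  then have 2: "(?F (insert x J) has_sum (\<Prod>j\<in>insert x J. infsum (f j) (B j))) (PiE (insert x J) B)"
    by (subst has_sum_reindex_bij_betw[OF bij, symmetric]) (simp only: case_prod_unfold val)
  from 1 2 show ?case by blast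
qed

lemma finite_PiE_nat_sum_eq:
  assumes "finite J"
  shows "finite {r \<in> PiE J (\<lambda>_. UNIV :: nat set). sum r J = m}"
proof (rule finite_subset)
  show "{r \<in> PiE J (\<lambda>_. UNIV :: nat set). sum r J = m} \<subseteq> PiE J (\<lambda>_. {..m})"
    using assms by (auto simp: PiE_def intro: member_le_sum)
qed (use assms in \<open>auto intro: finite_PiE\<close>)

text \<open>The iterated Cauchy product: the exponent \<open>m\<close> is distributed over the
  factors in all possible ways. The induction peels off the exponent of the factor
  \<open>x\<close>.\<close>

lemma fps_nth_prod_PiE:
  fixes f :: "'a \<Rightarrow> 'b::comm_ring_1 fps"
  assumes "finite J"
  shows "(\<Prod>j\<in>J. f j) $ m = (\<Sum>r | r \<in> PiE J (\<lambda>_. UNIV) \<and> sum r J = m. \<Prod>j\<in>J. f j $ r j)"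
  using assms
proof (induction J arbitrary: m)
  case empty
  have "{r. r \<in> PiE {} (\<lambda>_. UNIV :: nat set) \<and> sum r {} = m} = (if m = 0 then {\<lambda>_. undefined} else {})"
    by auto
  then show ?case by simp
next
  case (insert x J)
  let ?R = "\<lambda>J m. {r. r \<in> PiE J (\<lambda>_. UNIV :: nat set) \<and> sum r J = m}"
  have "(\<Prod>j\<in>insert x J. f j) $ m = (\<Sum>i=0..m. f x $ i * (\<Sum>r\<in>?R J (m - i). \<Prod>j\<in>J. f j $ r j))"
    using insert by (simp add: fps_mult_nth)
  also have "\<dots> = (\<Sum>(i, r)\<in>Sigma {0..m} (\<lambda>i. ?R J (m - i)). f x $ i * (\<Prod>j\<in>J. f j $ r j))"
    using finite_PiE_nat_sum_eq[OF insert.hyps(1)] by (simp add: sum_distrib_left sum.Sigma)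
  also have "\<dots> = (\<Sum>r\<in>?R (insert x J) m. \<Prod>j\<in>insert x J. f j $ r j)"
  proof (rule sum.reindex_bij_witness[where i = "\<lambda>r. (r x, r(x := undefined))" and
        j = "\<lambda>(i, r). r(x := i)"], goal_cases)
    case (1 a)
    then show ?case using insert.hyps by (auto simp: PiE_iff extensional_def fun_eq_iff)
  next
    case (2 a)
    obtain i r where a: "a = (i, r)" by force
    have "sum (r(x := i)) J = sum r J" using insert.hyps by (intro sum.cong) auto
    then show ?case using 2 insert.hyps by (auto simp: a PiE_iff extensional_def)
  next
    case (3 r)
    then show ?case by auto
  next
    case (4 r)
    have "sum (r(x := undefined)) J = sum r J" using insert.hyps by (intro sum.cong) auto
    then show ?case using 4 insert.hyps by (auto simp: PiE_iff extensional_def)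
  next
    case (5 a)
    obtain i r where a: "a = (i, r)" by force
    have "(\<Prod>j\<in>J. f j $ (r(x := i)) j) = (\<Prod>j\<in>J. f j $ r j)"
      using insert.hyps by (intro prod.cong) auto
    then show ?case using insert.hyps by (simp add: a)
  qed
  finally show ?case .
qed

lemma norm_summable_iff_abs_summable_on:
  fixes f :: "nat \<Rightarrow> 'a::real_normed_vector"
  shows "f abs_summable_on UNIV \<longleftrightarrow> summable (\<lambda>n. norm (f n))"
  by (rule summable_on_UNIV_nonneg_real_iff) simp

text \<open>The sum over all \<open>(r, s)\<close> with equal totals, grouped by the common total on one side and by
  \<open>(r - min r s, s - min r s)\<close> on the other.\<close>

lemma has_sum_MN_index:
  fixes F E :: "nat \<Rightarrow> complex fps"
  assumes F: "\<And>j. j \<in> {1..l} \<Longrightarrow> summable (\<lambda>n. norm (F j $ n))"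
    and E: "\<And>j. j \<in> {1..l} \<Longrightarrow> summable (\<lambda>n. norm (E j $ n))"
  obtains T where
    "((\<lambda>(M, N). \<Prod>j=1..l. \<Sum>i. F j $ (M j + i) * E j $ (N j + i)) has_sum T) (MN_index l)"
    "(\<lambda>m. (\<Prod>j=1..l. F j) $ m * (\<Prod>j=1..l. E j) $ m) sums T"
proof -
  define J where "J = {1..l}"
  define P where "P = PiE J (\<lambda>_. UNIV :: nat set)"
  define \<Phi> where "\<Phi> = (\<lambda>(r, s). (\<Prod>j\<in>J. F j $ r j) * (\<Prod>j\<in>J. E j $ s j))"
  define \<Omega> where "\<Omega> = {(r, s). r \<in> P \<and> s \<in> P \<and> sum r J = sum s J}"
  have fin: "finite J" by (simp add: J_def)
  have PF: "(\<lambda>r. \<Prod>j\<in>J. F j $ r j) abs_summable_on P"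
    and PE: "(\<lambda>s. \<Prod>j\<in>J. E j $ s j) abs_summable_on P"
    unfolding P_def using F E
    by (intro prod_PiE_abs_summable_has_sum[THEN conjunct1] fin;
        simp add: norm_summable_iff_abs_summable_on J_def)+
  have "\<Phi> abs_summable_on P \<times> P"
    unfolding \<Phi>_def using abs_summable_on_times[OF PF PE] .
  then have "\<Phi> abs_summable_on \<Omega>"
    by (rule summable_on_subset_banach) (auto simp: \<Omega>_def)
  then obtain T where T: "(\<Phi> has_sum T) \<Omega>"
    using abs_summable_summable summable_on_def by blast
  \<comment> \<open>First grouping: the pairs with common total \<open>m\<close> form the finite
    square \<open>R m \<times> R m\<close>, and the sum of \<Phi> over it factors into two
    coefficients of product series.\<close>
  have "((\<lambda>m. (\<Prod>j=1..l. F j) $ m * (\<Prod>j=1..l. E j) $ m) has_sum T) UNIV"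
  proof (rule has_sum_SigmaD)
    define R where "R m = {r. r \<in> P \<and> sum r J = m}" for m
    have finR: "finite (R m)" for m
      unfolding R_def P_def using finite_PiE_nat_sum_eq[OF fin] by simp
    have bij: "bij_betw snd (Sigma UNIV (\<lambda>m. R m \<times> R m)) \<Omega>"
      by (rule bij_betwI[where g = "\<lambda>(r, s). (sum r J, (r, s))"]) (auto simp: R_def \<Omega>_def)
    show "((\<lambda>x. \<Phi> (snd x)) has_sum T) (Sigma UNIV (\<lambda>m. R m \<times> R m))"
      using T by (subst has_sum_reindex_bij_betw[OF bij])
    fix m :: nat
    have "(\<Prod>j=1..l. F j) $ m * (\<Prod>j=1..l. E j) $ m = sum \<Phi> (R m \<times> R m)"
      using fps_nth_prod_PiE[OF fin, of F m] fps_nth_prod_PiE[OF fin, of E m]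
      by (simp add: J_def \<Phi>_def R_def P_def sum_product sum.cartesian_product)
    then show "((\<lambda>y. \<Phi> (snd (m, y))) has_sum (\<Prod>j=1..l. F j) $ m * (\<Prod>j=1..l. E j) $ m) (R m \<times> R m)"
      using has_sum_finite[of "R m \<times> R m" \<Phi>] finR by simp
  qed
  then have 1: "(\<lambda>m. (\<Prod>j=1..l. F j) $ m * (\<Prod>j=1..l. E j) $ m) sums T"
    by (rule has_sum_imp_sums)
  have "((\<lambda>(M, N). \<Prod>j=1..l. \<Sum>i. F j $ (M j + i) * E j $ (N j + i)) has_sum T) (MN_index l)"
  proof (rule has_sum_SigmaD)
    \<comment> \<open>Second grouping: \<open>i\<close> is the common part, recovered as the
      pointwise minimum of \<open>r\<close> and \<open>s\<close>. The restrictions keep the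
      functions extensional, as membership in \<open>PiE\<close> demands.\<close>
    let ?h = "\<lambda>((M, N), i). (restrict (\<lambda>j. M j + i j) J, restrict (\<lambda>j. N j + i j) J)"
    have bij: "bij_betw ?h (MN_index l \<times> P) \<Omega>"
    proof (rule bij_betwI[where g = "\<lambda>(r, s). ((restrict (\<lambda>j. r j - min (r j) (s j)) J,
          restrict (\<lambda>j. s j - min (r j) (s j)) J), restrict (\<lambda>j. min (r j) (s j)) J)"], goal_cases)
      case 1
      show ?case by (auto simp: MN_index_def \<Omega>_def P_def J_def sum.distrib)
    next
      case 2
      \<comment> \<open>The same amount is removed from both sides, so equality of the totals
        survives.\<close>
      have "sum (\<lambda>j. r j - min (r j) (s j)) J = sum (\<lambda>j. s j - min (r j) (s j)) J"
        if "sum r J = sum s J" for r s :: "nat \<Rightarrow> nat"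
      proof -
        have "sum (\<lambda>j. r j - min (r j) (s j)) J = sum r J - (\<Sum>j\<in>J. min (r j) (s j))"
          by (rule sum_subtractf_nat) auto
        also have "\<dots> = sum (\<lambda>j. s j - min (r j) (s j)) J"
          unfolding that by (rule sum_subtractf_nat[symmetric]) auto
        finally show ?thesis .
      qed
      then show ?case by (auto simp: MN_index_def \<Omega>_def P_def J_def)
    next
      case (3 x)
      obtain M N i where x: "x = ((M, N), i)" by (metis prod.exhaust)
      \<comment> \<open>Since \<open>M j\<close> or \<open>N j\<close> vanishes, adding
        \<open>i j\<close> to both makes \<open>i j\<close> their minimum, so the decomposition is
        unique.\<close>
      have m: "min (M j + i j) (N j + i j) = i j" if "j \<in> J" for j
        using 3 that by (fastforce simp: x MN_index_def J_def min_def split: if_splits)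
      show ?case using 3 m
        by (auto simp: x MN_index_def P_def J_def PiE_iff extensional_def fun_eq_iff)
    next
      case (4 y)
      then show ?case
        by (auto simp: \<Omega>_def P_def PiE_iff extensional_def fun_eq_iff)
    qed
    show "((\<lambda>x. \<Phi> (?h x)) has_sum T) (MN_index l \<times> P)"
      using T by (subst has_sum_reindex_bij_betw[OF bij])
    fix MN assume "MN \<in> MN_index l"
    obtain M N where MN: "MN = (M, N)" by force
    \<comment> \<open>The family over \<open>i\<close> is a diagonal inside the absolutely summable
      double family of all products.\<close>
    have S: "(\<lambda>i. F j $ (M j + i) * E j $ (N j + i)) abs_summable_on UNIV" if "j \<in> J" for j
    proof -
      have "(\<lambda>(r, s). F j $ r * E j $ s) abs_summable_on UNIV \<times> UNIV"
        using F E that by (intro abs_summable_on_times) (auto simp: norm_summable_iff_abs_summable_on J_def)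
      then have "(\<lambda>(r, s). F j $ r * E j $ s) abs_summable_on range (\<lambda>i. (M j + i, N j + i))"
        by (rule summable_on_subset_banach) auto
      then show ?thesis by (subst (asm) summable_on_reindex) (auto simp: inj_on_def o_def)
    qed
    have "((\<lambda>i. \<Prod>j\<in>J. F j $ (M j + i j) * E j $ (N j + i j)) has_sum
        (\<Prod>j\<in>J. \<Sum>\<^sub>\<infinity>i. F j $ (M j + i) * E j $ (N j + i))) P"
      unfolding P_def by (rule prod_PiE_abs_summable_has_sum[OF fin S, THEN conjunct2])
    moreover have "(\<Sum>\<^sub>\<infinity>i. F j $ (M j + i) * E j $ (N j + i)) = (\<Sum>i. F j $ (M j + i) * E j $ (N j + i))"
      if "j \<in> J" for j
      using has_sum_imp_sums[OF has_sum_infsum[OF abs_summable_summable[OF S[OF that]]]]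
      by (rule sums_unique)
    moreover have "\<Phi> (?h (MN, i)) = (\<Prod>j\<in>J. F j $ (M j + i j) * E j $ (N j + i j))" for i
      by (simp add: \<Phi>_def MN prod.distrib)
    ultimately show "((\<lambda>i. \<Phi> (?h (MN, i))) has_sum
        (case MN of (M, N) \<Rightarrow> \<Prod>j=1..l. \<Sum>i. F j $ (M j + i) * E j $ (N j + i))) P"
      by (simp add: MN J_def)
  qed
  with 1 show thesis using that by blast
qed

section \<open>Generating functions at a prime\<close>

definition geom_fps :: "complex \<Rightarrow> complex fps" where
  "geom_fps c = Abs_fps (\<lambda>n. c ^ n)"

definition lin_fps :: "complex \<Rightarrow> complex fps" where
  "lin_fps c = 1 - fps_const c * fps_X"

text \<open>The Euler factor at \<open>p\<close> of the quotient of zeta products attached to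
  \<open>C\<close> and \<open>D\<close>, with p^(-s) replaced by \<open>q\<close> times the formal
  variable. The scale \<open>q\<close> lets every evaluation be a plain sum of coefficients.\<close>

definition I_fps :: "nat \<Rightarrow> complex \<Rightarrow> complex multiset \<Rightarrow> complex multiset \<Rightarrow> complex fps" where
  "I_fps p q C D = (\<Prod>\<gamma>\<in>#C. geom_fps (q * of_nat p powr (-\<gamma>))) *
                   (\<Prod>\<delta>\<in>#D. lin_fps (q * of_nat p powr (-\<delta>)))"

lemma geom_fps_nth [simp]: "geom_fps c $ n = c ^ n"
  by (simp add: geom_fps_def)

lemma lin_fps_mult_nth: "(lin_fps c * f) $ n = f $ n - (if n = 0 then 0 else c * f $ (n - 1))"
  by (simp add: lin_fps_def left_diff_distrib mult.assoc)

lemma geom_fps_mult_lin_fps: "geom_fps c * lin_fps c = 1"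
proof (rule fps_ext)
  fix n
  show "(geom_fps c * lin_fps c) $ n = 1 $ n"
    using lin_fps_mult_nth[of c "geom_fps c" n] by (cases n) (simp_all add: mult.commute)
qed

lemma I_fps_add: "I_fps p q (C + C') (D + D') = I_fps p q C D * I_fps p q C' D'"
  by (simp add: I_fps_def mult_ac)

lemma I_fps_empty: "I_fps p q {#} {#} = 1"
  by (simp add: I_fps_def)

lemma I_fps_sum:
  "finite J \<Longrightarrow> (\<Prod>j\<in>J. I_fps p q (C j) (D j)) = I_fps p q (\<Sum>j\<in>J. C j) (\<Sum>j\<in>J. D j)"
  by (induction J rule: finite_induct) (simp_all add: I_fps_empty I_fps_add)

section \<open>Dirichlet coefficients at powers of a prime\<close>

lemma mobius_prime_power:
  assumes "prime (p::nat)"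
  shows "mobius (p ^ k) = (if k = 0 then 1 else if k = 1 then -1 else 0)"
  using assms
  by (auto simp: mobius_def squarefree_power_iff squarefree_prime
      prime_prime_factors prime_factors_power)

lemma finite_factorization_pairs:
  assumes "m > 0"
  shows "finite {(ms, ns::nat list). length ms = a \<and> length ns = b \<and> prod_list ms * prod_list ns = m}"
proof (rule finite_subset)
  let ?L = "\<lambda>k. \<Union>d\<in>{d. d dvd m}. {ms. length ms = k \<and> prod_list ms = d}"
  show "{(ms, ns::nat list). length ms = a \<and> length ns = b \<and> prod_list ms * prod_list ns = m} \<subseteq> ?L a \<times> ?L b"
    by auto
  have "finite (?L k)" for k
    using assms by (intro finite_UN_I finite_divisors_nat finite_fixed_prod) (auto intro: Nat.gr0I)
  then show "finite (?L a \<times> ?L b)" by blast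
qed

lemma prime_power_eq_mult_nat:
  fixes p :: nat
  assumes "prime p" "a * b = p ^ n"
  obtains i where "i \<le> n" "a = p ^ i" "b = p ^ (n - i)"
proof -
  have "a dvd p ^ n" using assms(2) by (metis dvd_triv_left)
  then obtain i where i: "i \<le> n" "a = p ^ i" using divides_primepow_nat[OF assms(1)] by blast
  have "p ^ i * b = p ^ i * p ^ (n - i)" using assms(2) i by (simp flip: power_add)
  then have "b = p ^ (n - i)" using assms(1) by (simp add: prime_gt_0_nat)
  with i that show thesis by blast
qed

text \<open>The first entry of a factorization of \<open>p ^ n\<close> is some \<open>p ^ i\<close>,
  and deleting it leaves a factorization of \<open>p ^ (n - i)\<close>. The inverse map reads off
  \<open>i\<close> as a multiplicity.\<close>

lemma I_list_prime_power_Cons_left: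
  assumes "prime p"
  shows "I_list (c # cs) ds (p ^ n) =
    (\<Sum>i\<le>n. of_nat (p ^ i) powr (-c) * I_list cs ds (p ^ (n - i)))"
proof -
  have p: "p > 1" "p > 0" using assms prime_gt_1_nat prime_gt_0_nat by auto
  let ?S = "\<lambda>cs m. {(ms, ns). length ms = length cs \<and> length ns = length ds \<and> prod_list ms * prod_list ns = (m::nat)}"
  let ?f = "\<lambda>cs (ms, ns). (\<Prod>i<length cs. of_nat (ms ! i) powr (- (cs ! i))) *
        (\<Prod>i<length ds. of_int (mobius (ns ! i)) * of_nat (ns ! i) powr (- (ds ! i))) :: complex"
  have "(\<Sum>i\<le>n. of_nat (p ^ i) powr (-c) * I_list cs ds (p ^ (n - i))) =
     (\<Sum>(i, x)\<in>Sigma {..n} (\<lambda>i. ?S cs (p ^ (n - i))). of_nat (p ^ i) powr (-c) * ?f cs x)"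
    unfolding I_list_def sum_distrib_left
    by (subst sum.Sigma) (use p in \<open>auto intro!: finite_factorization_pairs\<close>)
  also have "\<dots> = (\<Sum>x\<in>?S (c # cs) (p ^ n). ?f (c # cs) x)"
  proof (rule sum.reindex_bij_witness[where
        j = "\<lambda>(i, (ms, ns)). (p ^ i # ms, ns)" and
        i = "\<lambda>(ms, ns). (multiplicity p (hd ms), (tl ms, ns))"], goal_cases)
    case (1 a)
    then show ?case using assms by (auto simp: multiplicity_prime_power)
  next
    case (2 a)
    then show ?case by (auto simp: mult.assoc simp flip: power_add)
  next
    case (3 b)
    obtain m ms ns where b: "b = (m # ms, ns)" using 3 by (auto simp: length_Suc_conv)
    then have "m * (prod_list ms * prod_list ns) = p ^ n" using 3 by (simp add: mult.assoc)
    then obtain i where "m = p ^ i" using prime_power_eq_mult_nat[OF assms] by metis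
    then show ?case using assms by (simp add: b multiplicity_prime_power)
  next
    case (4 b)
    obtain m ms ns where b: "b = (m # ms, ns)" using 4 by (auto simp: length_Suc_conv)
    then have "m * (prod_list ms * prod_list ns) = p ^ n" using 4 by (simp add: mult.assoc)
    then obtain i where "i \<le> n" "m = p ^ i" "prod_list ms * prod_list ns = p ^ (n - i)"
      using prime_power_eq_mult_nat[OF assms] by metis
    then show ?case using 4 assms by (simp add: b multiplicity_prime_power)
  next
    case (5 a)
    then show ?case
      by (auto simp: prod.lessThan_Suc_shift mult.assoc simp del: prod.lessThan_Suc of_nat_power)
  qed
  finally show ?thesis unfolding I_list_def by simp
qed

text \<open>The same peeling for the entries that carry a Moebius weight.\<close>

lemma I_list_prime_power_Cons_right:
  assumes "prime p"
  shows "I_list cs (d # ds) (p ^ n) =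
    (\<Sum>i\<le>n. of_int (mobius (p ^ i)) * of_nat (p ^ i) powr (-d) * I_list cs ds (p ^ (n - i)))"
proof -
  have p: "p > 1" "p > 0" using assms prime_gt_1_nat prime_gt_0_nat by auto
  let ?S = "\<lambda>ds m. {(ms, ns). length ms = length cs \<and> length ns = length ds \<and> prod_list ms * prod_list ns = (m::nat)}"
  let ?f = "\<lambda>ds (ms, ns). (\<Prod>i<length cs. of_nat (ms ! i) powr (- (cs ! i))) *
        (\<Prod>i<length ds. of_int (mobius (ns ! i)) * of_nat (ns ! i) powr (- (ds ! i))) :: complex"
  have "(\<Sum>i\<le>n. of_int (mobius (p ^ i)) * of_nat (p ^ i) powr (-d) * I_list cs ds (p ^ (n - i))) =
     (\<Sum>(i, x)\<in>Sigma {..n} (\<lambda>i. ?S ds (p ^ (n - i))). of_int (mobius (p ^ i)) * of_nat (p ^ i) powr (-d) * ?f ds x)"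
    unfolding I_list_def sum_distrib_left
    by (subst sum.Sigma) (use p in \<open>auto intro!: finite_factorization_pairs\<close>)
  also have "\<dots> = (\<Sum>x\<in>?S (d # ds) (p ^ n). ?f (d # ds) x)"
  proof (rule sum.reindex_bij_witness[where
        j = "\<lambda>(i, (ms, ns)). (ms, p ^ i # ns)" and
        i = "\<lambda>(ms, ns). (multiplicity p (hd ns), (ms, tl ns))"], goal_cases)
    case (1 a)
    then show ?case using assms by (auto simp: multiplicity_prime_power)
  next
    case (2 a)
    then show ?case by (auto simp: mult.left_commute[of _ "p ^ _"] simp flip: power_add)
  next
    case (3 b)
    obtain m ms ns where b: "b = (ms, m # ns)" using 3 by (auto simp: length_Suc_conv)
    then have "m * (prod_list ms * prod_list ns) = p ^ n" using 3 by (simp add: mult_ac)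
    then obtain i where "m = p ^ i" using prime_power_eq_mult_nat[OF assms] by metis
    then show ?case using assms by (simp add: b multiplicity_prime_power)
  next
    case (4 b)
    obtain m ms ns where b: "b = (ms, m # ns)" using 4 by (auto simp: length_Suc_conv)
    then have "m * (prod_list ms * prod_list ns) = p ^ n" using 4 by (simp add: mult_ac)
    then obtain i where "i \<le> n" "m = p ^ i" "prod_list ms * prod_list ns = p ^ (n - i)"
      using prime_power_eq_mult_nat[OF assms] by metis
    then show ?case using 4 assms by (simp add: b multiplicity_prime_power)
  next
    case (5 a)
    then show ?case
      by (auto simp: prod.lessThan_Suc_shift mult_ac simp del: prod.lessThan_Suc of_nat_power)
  qed
  finally show ?thesis unfolding I_list_def by simp
qed

lemma of_nat_power_powr: "of_nat (p ^ i) powr (s::complex) = (of_nat p powr s) ^ i"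
proof (induction i)
  case (Suc i)
  have "of_nat (p ^ Suc i) powr s = of_nat p powr s * of_nat (p ^ i) powr s"
    using powr_times_real[of "of_nat p" "of_nat (p ^ i)" s]
    by (simp del: of_nat_power flip: of_nat_mult)
  with Suc show ?case by simp
qed simp

text \<open>Adding an entry to \<open>cs\<close> is a Cauchy product with a geometric series. Adding
  one to \<open>ds\<close> multiplies by a linear polynomial, because the Moebius function vanishes
  at \<open>p ^ i\<close> for \<open>i \<ge> 2\<close>.\<close>

lemma I_fps_nth:
  assumes "prime p"
  shows "I_fps p q C D $ n = q ^ n * I_coeff C D (p ^ n)"
proof -
  have p: "p > 1" "p > 0" using assms prime_gt_1_nat prime_gt_0_nat by auto
  have "I_fps p q (mset cs) (mset ds) $ n = q ^ n * I_list cs ds (p ^ n)" for cs ds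
  proof (induction cs arbitrary: n)
    case Nil
    show ?case
    proof (induction ds arbitrary: n)
      case Nil
      have "{(ms, ns). length ms = length ([]::complex list) \<and> length ns = length ([]::complex list) \<and>
          prod_list ms * prod_list ns = p ^ n} = (if n = 0 then {([],[])} else {})"
        using p by (auto simp: eq_commute[of _ "p ^ n"])
      then show ?case by (simp add: I_list_def I_fps_empty)
    next
      case (Cons d ds)
      have "I_list [] (d # ds) (p ^ n) = (\<Sum>i\<le>n. of_int (mobius (p ^ i)) * of_nat (p ^ i) powr (-d) *
                I_list [] ds (p ^ (n - i)))"
        by (rule I_list_prime_power_Cons_right[OF assms])
      \<comment> \<open>The bound \<open>min n 1\<close> covers \<open>n = 0\<close> as well, where
        only the term \<open>i = 0\<close> exists.\<close>
      also have "\<dots> = (\<Sum>i\<in>{..min n 1}. of_int (mobius (p ^ i)) * of_nat (p ^ i) powr (-d) *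
                I_list [] ds (p ^ (n - i)))"
        by (rule sum.mono_neutral_right) (auto simp: mobius_prime_power[OF assms])
      also have "\<dots> = I_list [] ds (p ^ n) - (if n = 0 then 0 else of_nat p powr (-d) * I_list [] ds (p ^ (n - 1)))"
        using mobius_prime_power[OF assms, of 0] mobius_prime_power[OF assms, of 1]
        by (cases n) simp_all
      finally have *: "I_list [] (d # ds) (p ^ n) = \<dots>" .
      have "I_fps p q (mset []) (mset (d # ds)) = lin_fps (q * of_nat p powr (-d)) * I_fps p q (mset []) (mset ds)"
        by (simp add: I_fps_def)
      then have "I_fps p q (mset []) (mset (d # ds)) $ n = q ^ n * I_list [] ds (p ^ n) -
          (if n = 0 then 0 else q * of_nat p powr (-d) * (q ^ (n - 1) * I_list [] ds (p ^ (n - 1))))"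
        using Cons by (simp only: lin_fps_mult_nth)
      then show ?case
        unfolding * by (cases n) (simp_all add: algebra_simps)
    qed
  next
    case (Cons c cs)
    have "I_fps p q (mset (c # cs)) (mset ds) = geom_fps (q * of_nat p powr (-c)) * I_fps p q (mset cs) (mset ds)"
      by (simp add: I_fps_def mult_ac)
    then have "I_fps p q (mset (c # cs)) (mset ds) $ n =
        (\<Sum>i\<le>n. (q * of_nat p powr (-c)) ^ i * (q ^ (n - i) * I_list cs ds (p ^ (n - i))))"
      using Cons by (simp add: fps_mult_nth atLeast0AtMost)
    also have "\<dots> = (\<Sum>i\<le>n. q ^ n * ((of_nat p powr (-c)) ^ i * I_list cs ds (p ^ (n - i))))"
    proof (rule sum.cong[OF refl])
      fix i assume "i \<in> {..n}"
      then have "q ^ n = q ^ i * q ^ (n - i)" by (simp flip: power_add)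
      then show "(q * of_nat p powr (-c)) ^ i * (q ^ (n - i) * I_list cs ds (p ^ (n - i))) =
          q ^ n * ((of_nat p powr (-c)) ^ i * I_list cs ds (p ^ (n - i)))"
        by (simp add: power_mult_distrib)
    qed
    also have "\<dots> = q ^ n * I_list (c # cs) ds (p ^ n)"
      unfolding I_list_prime_power_Cons_left[OF assms] sum_distrib_left of_nat_power_powr ..
    finally show ?case .
  qed
  then show ?thesis using I_coeff_mset by (metis ex_mset)
qed

section \<open>Absolute convergence and evaluation of power series at 1\<close>

lemma summable_norm_fps_mult:
  fixes f g :: "complex fps"
  assumes "summable (\<lambda>n. norm (f $ n))" "summable (\<lambda>n. norm (g $ n))"
  shows "summable (\<lambda>n. norm ((f * g) $ n))"
proof (rule summable_norm_comparison_test)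
  show "summable (\<lambda>n. \<Sum>i\<le>n. norm (f $ i) * norm (g $ (n - i)))"
    by (rule summable_Cauchy_product) (use assms in simp_all)
  show "\<exists>N. \<forall>n\<ge>N. norm ((f * g) $ n) \<le> (\<Sum>i\<le>n. norm (f $ i) * norm (g $ (n - i)))"
    by (auto simp: fps_mult_nth atLeast0AtMost norm_mult intro!: sum_norm_le)
qed

lemma suminf_fps_mult:
  fixes f g :: "complex fps"
  assumes "summable (\<lambda>n. norm (f $ n))" "summable (\<lambda>n. norm (g $ n))"
  shows "(\<Sum>n. (f * g) $ n) = (\<Sum>n. f $ n) * (\<Sum>n. g $ n)"
  using Cauchy_product[OF assms] by (simp add: fps_mult_nth atLeast0AtMost)

lemma lin_fps_sums: "(\<lambda>n. lin_fps c $ n) sums (1 - c)"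
  and summable_norm_lin_fps: "summable (\<lambda>n. norm (lin_fps c $ n))"
proof -
  have *: "lin_fps c $ n = 0" if "n \<notin> {0, 1}" for n
    using that lin_fps_mult_nth[of c 1 n] by simp
  have "lin_fps c $ 0 = 1" "lin_fps c $ 1 = -c"
    using lin_fps_mult_nth[of c 1] by simp_all
  then show "(\<lambda>n. lin_fps c $ n) sums (1 - c)"
    using sums_finite[of "{0, 1}" "\<lambda>n. lin_fps c $ n"] * by simp
  show "summable (\<lambda>n. norm (lin_fps c $ n))"
    by (rule summable_finite[of "{0, 1}"]) (use * in auto)
qed

lemma summable_norm_prod_mset_lin_fps:
  "summable (\<lambda>n. norm ((\<Prod>\<delta>\<in>#D. lin_fps (f \<delta>)) $ n))"
proof (induction D)
  case empty
  show ?case by (rule summable_finite[of "{0}"]) auto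
next
  case (add x D)
  then show ?case by (simp add: summable_norm_fps_mult summable_norm_lin_fps)
qed

lemma suminf_prod_mset_lin_fps:
  "(\<Sum>n. (\<Prod>\<delta>\<in>#D. lin_fps (f \<delta>)) $ n) = (\<Prod>\<delta>\<in>#D. 1 - f \<delta>)"
proof (induction D)
  case empty
  show ?case using suminf_finite[of "{0}" "\<lambda>n. (1 :: complex fps) $ n"] by simp
next
  case (add x D)
  then show ?case
    using sums_unique[OF lin_fps_sums[of "f x"]]
    by (simp add: suminf_fps_mult summable_norm_lin_fps summable_norm_prod_mset_lin_fps)
qed

lemma summable_norm_I_fps:
  assumes "\<And>\<gamma>. \<gamma> \<in># C \<Longrightarrow> norm (q * of_nat p powr (-\<gamma>)) < 1"
  shows "summable (\<lambda>n. norm (I_fps p q C D $ n))"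
proof -
  have "summable (\<lambda>n. norm ((\<Prod>\<gamma>\<in>#C. geom_fps (q * of_nat p powr (-\<gamma>))) $ n))"
    using assms
  proof (induction C)
    case (add x C)
    have "summable (\<lambda>n. norm (geom_fps (q * of_nat p powr (-x)) $ n))"
      using add.prems[of x] by (simp add: norm_power summable_geometric)
    then show ?case using add by (auto intro!: summable_norm_fps_mult)
  next
    case empty
    show ?case by (rule summable_finite[of "{0}"]) auto
  qed
  then show ?thesis
    unfolding I_fps_def by (intro summable_norm_fps_mult summable_norm_prod_mset_lin_fps)
qed

text \<open>The linear and geometric factors are inverse as power series. Both sides converge
  absolutely, so summing coefficients is multiplicative and carries this relation over to
  numbers.\<close>

lemma suminf_I_fps:
  assumes "\<And>\<gamma>. \<gamma> \<in># C \<Longrightarrow> norm (q * of_nat p powr (-\<gamma>)) < 1"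
  shows "(\<Prod>\<gamma>\<in>#C. 1 - q * of_nat p powr (-\<gamma>)) * (\<Sum>n. I_fps p q C {#} $ n) = 1"
proof -
  have "(\<Prod>\<gamma>\<in>#C. lin_fps (q * of_nat p powr (-\<gamma>))) * I_fps p q C {#} = 1"
  proof (induction C)
    case (add x C)
    let ?c = "q * of_nat p powr (-x)"
    have "(\<Prod>\<gamma>\<in>#add_mset x C. lin_fps (q * of_nat p powr (-\<gamma>))) * I_fps p q (add_mset x C) {#} =
        (geom_fps ?c * lin_fps ?c) * ((\<Prod>\<gamma>\<in>#C. lin_fps (q * of_nat p powr (-\<gamma>))) * I_fps p q C {#})"
      by (simp add: I_fps_def mult_ac)
    then show ?case unfolding geom_fps_mult_lin_fps add by simp
  qed (simp add: I_fps_def)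
  moreover have "(\<Sum>n. (1 :: complex fps) $ n) = 1"
    using suminf_finite[of "{0}" "\<lambda>n. (1 :: complex fps) $ n"] by simp
  moreover have "(\<Sum>n. ((\<Prod>\<gamma>\<in>#C. lin_fps (q * of_nat p powr (-\<gamma>))) * I_fps p q C {#}) $ n) =
      (\<Prod>\<gamma>\<in>#C. 1 - q * of_nat p powr (-\<gamma>)) * (\<Sum>n. I_fps p q C {#} $ n)"
    unfolding suminf_prod_mset_lin_fps[symmetric]
    by (intro suminf_fps_mult summable_norm_prod_mset_lin_fps summable_norm_I_fps assms)
  ultimately show ?thesis by (simp only:)
qed

section \<open>The local factors\<close>

lemma has_sum_atLeast_suminf:
  fixes f :: "nat \<Rightarrow> complex"
  assumes "summable (\<lambda>n. norm (f n))"
  shows "(f has_sum (\<Sum>n. f (n + k))) {k..}"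
proof -
  have "bij_betw (\<lambda>n. n + k) UNIV {k..}"
    by (rule bij_betwI[where g = "\<lambda>n. n - k"]) auto
  moreover have "((\<lambda>n. f (n + k)) has_sum (\<Sum>n. f (n + k))) UNIV"
    using assms summable_norm_cancel[OF assms] summable_iff_shift[of "\<lambda>n. norm (f n)" k]
    by (intro norm_summable_imp_has_sum) (auto simp: summable_iff_shift)
  ultimately show ?thesis by (subst (asm) has_sum_reindex_bij_betw)
qed

text \<open>Both sides sum the same kernel over \<open>(m, n)\<close>: the left-hand side by \<open>min (m + N) (n + M)\<close>,
  the right-hand side by \<open>max (m - M) (n - N)\<close>, where truncated subtraction is harmless because
  \<open>M\<close> or \<open>N\<close> vanishes.\<close>

lemma sum_by_min_eq_sum_by_max:
  fixes a b :: "nat \<Rightarrow> complex" and x y v U V X Y :: complex and M N :: nat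
  defines "S \<equiv> \<lambda>r. \<Sum>m. a (m + r) * x ^ (m + r)"
    and "T \<equiv> \<lambda>r. \<Sum>n. b (n + r) * y ^ (n + r)"
    and "F \<equiv> Abs_fps (\<lambda>m. a m * X ^ m) * geom_fps U"
    and "E \<equiv> Abs_fps (\<lambda>n. b n * Y ^ n) * geom_fps V"
  assumes MN: "min M N = 0"
    and rel: "x * v * U = X" "y * v * V = Y" "U * V * v = 1"
    and UV: "norm U < 1" "norm V < 1"
    and sums: "summable (\<lambda>m. norm (a m * x ^ m))" "summable (\<lambda>n. norm (b n * y ^ n))"
      "summable (\<lambda>m. norm (a m * X ^ m))" "summable (\<lambda>n. norm (b n * Y ^ n))"
  shows "(\<lambda>d. U ^ M * V ^ N * (v ^ d * (S (d - N) * T (d - M) - S (Suc d - N) * T (Suc d - M)))) sums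
           ((1 - U * V) * (\<Sum>i. F $ (M + i) * E $ (N + i)))"
proof -
  \<comment> \<open>The weight \<open>U ^ M * V ^ N\<close> is put into the kernel so that the
    exponents of \<open>U\<close> and \<open>V\<close> in its second form are nonnegative.\<close>
  define \<kappa> where "\<kappa> = (\<lambda>(m, n). U ^ M * V ^ N * (a m * x ^ m * (b n * y ^ n) * v ^ min (m + N) (n + M)))"
  define i0 where "i0 = (\<lambda>(m, n). max (m - M) (n - N))"
  \<comment> \<open>With \<open>i = i0 (m, n)\<close> the two extremal exponents satisfy
    \<open>min (m + N) (n + M) + i = m + n\<close>. Trading the minimum for \<open>i\<close> by
    \<open>U * V * v = 1\<close> turns \<open>x\<close> and \<open>y\<close> into \<open>X\<close>
    and \<open>Y\<close>.\<close>
  have \<kappa>: "\<kappa> (m, n) = a m * X ^ m * (b n * Y ^ n) * (U ^ (M + i0 (m, n) - m) * V ^ (N + i0 (m, n) - n))" for m n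
  proof -
    define i where "i = i0 (m, n)"
    have i: "m \<le> M + i" "n \<le> N + i" "min (m + N) (n + M) + i = m + n"
      using MN by (auto simp: i_def i0_def max_def min_def split: if_splits)
    have "v ^ (m + n) = v ^ min (m + N) (n + M) * v ^ i"
      by (simp flip: power_add add: i(3))
    moreover have "U ^ (M + i - m) * U ^ m = U ^ M * U ^ i" and "V ^ (N + i - n) * V ^ n = V ^ N * V ^ i"
      using i by (simp_all flip: power_add)
    ultimately have "x ^ m * y ^ n * v ^ (m + n) * (U ^ (M + i - m) * U ^ m) * (V ^ (N + i - n) * V ^ n) =
        U ^ M * V ^ N * (x ^ m * y ^ n * v ^ min (m + N) (n + M)) * (U ^ i * V ^ i * v ^ i)"
      by (simp only: mult_ac)
    also have "\<dots> = U ^ M * V ^ N * (x ^ m * y ^ n * v ^ min (m + N) (n + M))"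
      using rel(3) by (simp flip: power_mult_distrib)
    also have "x ^ m * y ^ n * v ^ (m + n) * (U ^ (M + i - m) * U ^ m) * (V ^ (N + i - n) * V ^ n) =
        X ^ m * Y ^ n * (U ^ (M + i - m) * V ^ (N + i - n))"
      by (simp add: rel(1,2)[symmetric] power_mult_distrib power_add mult_ac)
    finally show ?thesis by (simp add: \<kappa>_def i_def mult_ac)
  qed
  \<comment> \<open>The first form gives no direct bound, as \<open>v\<close> has norm greater than
    1. In the second form the powers of \<open>U\<close> and \<open>V\<close> are bounded by 1,
    which leaves a product of two absolutely convergent series.\<close>
  have summ: "\<kappa> abs_summable_on UNIV"
  proof (rule Infinite_Sum.abs_summable_on_comparison_test)
    show "(\<lambda>(m, n). a m * X ^ m * (b n * Y ^ n)) abs_summable_on UNIV"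
      using abs_summable_on_times[of "\<lambda>m. a m * X ^ m" UNIV "\<lambda>n. b n * Y ^ n" UNIV] sums(3,4)
      by (simp add: norm_summable_iff_abs_summable_on)
    fix mn :: "nat \<times> nat"
    obtain m n where mn: "mn = (m, n)" by force
    have "norm (U ^ j * V ^ k) \<le> 1" for j k
      using UV by (simp add: norm_mult norm_power mult_le_one power_le_one)
    then have "norm (a m * X ^ m * (b n * Y ^ n)) * norm (U ^ (M + i0 mn - m) * V ^ (N + i0 mn - n))
        \<le> norm (a m * X ^ m * (b n * Y ^ n)) * 1"
      by (intro mult_left_mono) auto
    then show "norm (\<kappa> mn) \<le> norm (case mn of (m, n) \<Rightarrow> a m * X ^ m * (b n * Y ^ n))"
      unfolding mn \<kappa> by (simp add: norm_mult)
  qed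
  then obtain K where K: "(\<kappa> has_sum K) UNIV"
    using abs_summable_summable summable_on_def by blast
  have group: "((\<lambda>d. h d) has_sum K) UNIV"
    if "\<And>d. (\<kappa> has_sum h d) {mn. \<phi> mn = d}" for \<phi> :: "nat \<times> nat \<Rightarrow> nat" and h
  proof (rule has_sum_SigmaD)
    have bij: "bij_betw snd (Sigma UNIV (\<lambda>d. {mn. \<phi> mn = d})) UNIV"
      by (rule bij_betwI[where g = "\<lambda>mn. (\<phi> mn, mn)"]) auto
    show "((\<lambda>z. \<kappa> (snd z)) has_sum K) (Sigma UNIV (\<lambda>d. {mn. \<phi> mn = d}))"
      using K by (subst has_sum_reindex_bij_betw[OF bij])
    show "((\<lambda>mn. \<kappa> (snd (d, mn))) has_sum h d) {mn. \<phi> mn = d}" for d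
      using that[of d] by simp
  qed

  have box: "((\<lambda>(m, n). a m * x ^ m * (b n * y ^ n)) has_sum S j * T k) ({j..} \<times> {k..})" for j k
    unfolding S_def T_def using sums(1,2)
    by (intro has_sum_times has_sum_atLeast_suminf
         summable_on_subset_banach[of _ UNIV "{_..}"])
       (auto simp: norm_summable_iff_abs_summable_on)
  \<comment> \<open>The pairs with \<open>min (m + N) (n + M) \<ge> d\<close> form the box
    \<open>{d - N..} \<times> {d - M..}\<close>, also when the subtractions truncate. The level
    \<open>d\<close> is therefore a difference of two consecutive boxes.\<close>
  have "((\<lambda>d. U ^ M * V ^ N * (v ^ d * (S (d - N) * T (d - M) - S (Suc d - N) * T (Suc d - M)))) has_sum K) UNIV"
  proof (rule group[where \<phi> = "\<lambda>(m, n). min (m + N) (n + M)"])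
    fix d
    let ?D = "{mn. (case mn of (m, n) \<Rightarrow> min (m + N) (n + M)) = d}"
    have "((\<lambda>(m, n). a m * x ^ m * (b n * y ^ n)) has_sum
        S (d - N) * T (d - M) - S (Suc d - N) * T (Suc d - M))
        ({d - N..} \<times> {d - M..} - {Suc d - N..} \<times> {Suc d - M..})"
      by (intro has_sum_Diff box) auto
    also have "{d - N..} \<times> {d - M..} - {Suc d - N..} \<times> {Suc d - M..} = ?D"
      using MN by (auto simp: min_def split: if_splits)
    finally have "((\<lambda>z. U ^ M * V ^ N * (v ^ d * (\<lambda>(m, n). a m * x ^ m * (b n * y ^ n)) z)) has_sum
        U ^ M * V ^ N * (v ^ d * (S (d - N) * T (d - M) - S (Suc d - N) * T (Suc d - M)))) ?D"
      by (intro has_sum_cmult_right)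
    then show "(\<kappa> has_sum U ^ M * V ^ N * (v ^ d * (S (d - N) * T (d - M) - S (Suc d - N) * T (Suc d - M)))) ?D"
      by (rule has_sum_cong[THEN iffD1, rotated]) (auto simp: \<kappa>_def mult_ac)
  qed
  then have D: "(\<lambda>d. U ^ M * V ^ N * (v ^ d * (S (d - N) * T (d - M) - S (Suc d - N) * T (Suc d - M)))) sums K"
    by (rule has_sum_imp_sums)

  \<comment> \<open>Now \<open>K\<close> is computed by the levels of \<open>i0\<close>. The box
    \<open>B i\<close> consists of the pairs with \<open>i0 \<le> i\<close>, and \<open>t i\<close>
    agrees with \<kappa> on the level \<open>i0 = i\<close>.\<close>
  define J where "J i = F $ (M + i) * E $ (N + i)" for i
  define B where "B i = {..M + i} \<times> {..N + i}" for i
  define t where "t i = (\<lambda>(m, n). a m * X ^ m * (b n * Y ^ n) * (U ^ (M + i - m) * V ^ (N + i - n)))" for i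
  have J: "J i = sum (t i) (B i)" for i
  proof -
    have "F $ (M + i) = (\<Sum>m\<le>M + i. a m * X ^ m * U ^ (M + i - m))"
      "E $ (N + i) = (\<Sum>n\<le>N + i. b n * Y ^ n * V ^ (N + i - n))"
      by (simp_all add: F_def E_def fps_mult_nth atLeast0AtMost)
    then show ?thesis
      by (simp add: J_def t_def B_def sum_product sum.cartesian_product mult_ac)
  qed
  \<comment> \<open>Passing to \<open>Suc i\<close> adds one factor \<open>U\<close> and one factor
    \<open>V\<close> on every old pair, so \<open>J (Suc i) - U * V * J i\<close> retains exactly
    the pairs new to the box.\<close>
  have tS: "t (Suc i) mn = U * V * t i mn" if "mn \<in> B i" for i mn
    using that by (auto simp: B_def t_def Suc_diff_le)
  have J0: "(\<kappa> has_sum J 0) {mn. i0 mn = 0}"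
  proof -
    have "{mn. i0 mn = 0} = B 0" by (auto simp: i0_def B_def)
    moreover have "J 0 = sum \<kappa> (B 0)"
      unfolding J by (rule sum.cong) (auto simp: \<kappa> t_def i0_def B_def)
    ultimately show ?thesis by (simp add: has_sum_finite B_def)
  qed
  have JS: "(\<kappa> has_sum (J (Suc i) - U * V * J i)) {mn. i0 mn = Suc i}" for i
  proof -
    have sub: "B i \<subseteq> B (Suc i)" and fin: "finite (B (Suc i))" by (auto simp: B_def)
    have eq: "{mn. i0 mn = Suc i} = B (Suc i) - B i"
      by (auto simp: i0_def B_def max_def split: if_splits)
    have "J (Suc i) - U * V * J i = sum (t (Suc i)) (B (Suc i)) - sum (t (Suc i)) (B i)"
      unfolding J sum_distrib_left using tS by (simp cong: sum.cong)
    also have "\<dots> = sum (t (Suc i)) (B (Suc i) - B i)"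
      using sum_diff[OF fin sub, of "t (Suc i)"] by simp
    also have "\<dots> = sum \<kappa> (B (Suc i) - B i)"
      unfolding eq[symmetric] by (rule sum.cong) (auto simp: \<kappa> t_def)
    finally show ?thesis unfolding eq using fin by (simp add: has_sum_finite)
  qed
  have "((\<lambda>i. J i - U * V * (if i = 0 then 0 else J (i - 1))) has_sum K) UNIV"
  proof (rule group)
    show "(\<kappa> has_sum J i - U * V * (if i = 0 then 0 else J (i - 1))) {mn. i0 mn = i}" for i
      using J0 JS[of "i - 1"] by (cases i) simp_all
  qed
  then have K': "(\<lambda>i. J i - U * V * (if i = 0 then 0 else J (i - 1))) sums K"
    by (rule has_sum_imp_sums)
  have geo: "summable (\<lambda>n. norm (geom_fps c $ n))" if "norm c < 1" for c
    using that by (simp add: norm_power summable_geometric)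
  have "summable (\<lambda>n. norm (F $ n))" "summable (\<lambda>n. norm (E $ n))"
    unfolding F_def E_def using sums(3,4) UV by (auto intro!: summable_norm_fps_mult geo)
  then have "(\<lambda>(r, s). F $ r * E $ s) abs_summable_on UNIV \<times> UNIV"
    by (intro abs_summable_on_times) (auto simp: norm_summable_iff_abs_summable_on)
  then have "(\<lambda>(r, s). F $ r * E $ s) abs_summable_on range (\<lambda>i. (M + i, N + i))"
    by (rule summable_on_subset_banach) auto
  then have "J abs_summable_on UNIV"
    by (subst (asm) summable_on_reindex) (auto simp: inj_on_def o_def J_def)
  then have sJ: "J sums suminf J"
    unfolding norm_summable_iff_abs_summable_on by (rule summable_sums[OF summable_norm_cancel])
  \<comment> \<open>Shifting by one place with a leading zero leaves the sum unchanged, so the level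
    sums add up to \<open>(1 - U * V) * suminf J\<close>.\<close>
  have "(\<lambda>i. if i = 0 then 0 else J (i - 1)) sums suminf J"
    using sJ sums_Suc_iff[of "\<lambda>i. if i = 0 then 0 else J (i - 1)" "suminf J"] by simp
  then have "(\<lambda>i. J i - U * V * (if i = 0 then 0 else J (i - 1))) sums (suminf J - U * V * suminf J)"
    by (intro sums_diff sJ sums_mult)
  with K' have "K = (1 - U * V) * suminf J"
    using sums_unique2 by (fastforce simp: algebra_simps)
  with D show ?thesis by (simp add: J_def[abs_def])
qed

section \<open>The functions \<open>g_fun\<close> and \<open>G_fun\<close> at powers of a
  prime\<close>

lemma of_nat_powr_power:
  assumes "p > 0"
  shows "(of_nat p powr (s::complex)) ^ n = of_nat p powr (of_nat n * s)"
  using assms by (simp add: powr_def mult.assoc flip: exp_of_nat_mult)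

lemma norm_of_nat_powr_less_1: "p > 1 \<Longrightarrow> Re s < 0 \<Longrightarrow> norm (of_nat p powr s) < 1"
  by (simp add: norm_of_nat_powr powr_less_one)

text \<open>The factor \<open>x ^ r\<close> completes the series in \<open>g_fun\<close> to a tail
  of the generating function of \<open>tau\<close> at powers of \<open>p\<close>.\<close>

lemma g_fun_prime_power:
  fixes p :: nat and E :: "complex multiset" and s :: complex
  defines "x \<equiv> of_nat p powr (-s)"
  assumes p: "prime p" and E: "\<And>\<gamma>. \<gamma> \<in># E \<Longrightarrow> norm (x * of_nat p powr (-\<gamma>)) < 1"
  shows "summable (\<lambda>m. tau E (p ^ (m + r)) * of_nat p powr (- (of_nat m * s)))"
    and "x ^ r * g_fun E s (p ^ r) =
      (\<Prod>\<gamma>\<in>#E. 1 - x * of_nat p powr (-\<gamma>)) * (\<Sum>m. I_fps p x E {#} $ (m + r))"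
proof -
  have p0: "p > 0" "p > 1" using p prime_gt_0_nat prime_gt_1_nat by auto
  then have x0: "x \<noteq> 0" by (simp add: x_def)
  have nth: "x ^ r * (tau E (p ^ (m + r)) * of_nat p powr (- (of_nat m * s))) = I_fps p x E {#} $ (m + r)" for m
  proof -
    have "of_nat p powr (- (of_nat m * s)) = x ^ m"
      using p0 by (simp add: x_def of_nat_powr_power)
    then show ?thesis
      using p0 by (simp add: I_fps_nth[OF p] tau_conv_I_coeff power_add mult_ac)
  qed
  have "summable (\<lambda>m. I_fps p x E {#} $ (m + r))"
    using summable_norm_cancel[OF summable_norm_I_fps[OF E]] by (simp add: summable_iff_shift)
  then have "summable (\<lambda>m. x ^ r * (tau E (p ^ (m + r)) * of_nat p powr (- (of_nat m * s))))"
    unfolding nth .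
  then show S: "summable (\<lambda>m. tau E (p ^ (m + r)) * of_nat p powr (- (of_nat m * s)))"
    using x0 by (simp add: summable_cmult_iff)
  show "x ^ r * g_fun E s (p ^ r) =
      (\<Prod>\<gamma>\<in>#E. 1 - x * of_nat p powr (-\<gamma>)) * (\<Sum>m. I_fps p x E {#} $ (m + r))"
  \<comment> \<open>At \<open>r = 0\<close> the product over prime factors is empty and
    \<open>g_fun\<close> equals 1. The right-hand side is then the full series times its inverse,
    again 1.\<close>
  proof (cases "r = 0")
    case True
    then show ?thesis using suminf_I_fps[OF E] by (simp add: g_fun_def)
  next
    case False
    have "prime_factors (p ^ r) = {p}"
      using p False by (simp add: prime_factors_power prime_prime_factors)
    moreover have "multiplicity p (p ^ r) = r"
      using p by (simp add: multiplicity_prime_power)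
    moreover have "of_nat p powr (- s - \<gamma>) = x * of_nat p powr (-\<gamma>)" for \<gamma>
      by (simp add: x_def flip: powr_add)
    ultimately have "x ^ r * g_fun E s (p ^ r) = (\<Prod>\<gamma>\<in>#E. 1 - x * of_nat p powr (-\<gamma>)) *
        (x ^ r * (\<Sum>m. tau E (p ^ (m + r)) * of_nat p powr (- (of_nat m * s))))"
      by (simp add: g_fun_def)
    then show ?thesis using nth suminf_mult[OF S, of "x ^ r"] by simp
  qed
qed

text \<open>The Moebius factor leaves only \<open>d = 1\<close> and \<open>d = p\<close>, and in the
  latter case \<open>e\<close> is 1 or \<open>p\<close>. The denominator is the totient of
  \<open>p\<close>.\<close>

lemma G_fun_prime_power_Suc:
  assumes p: "prime p"
  shows "G_fun E s (p ^ Suc r) = g_fun E s (p ^ Suc r) -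
     of_nat p powr s / (of_nat p - 1) * (g_fun E s (p ^ r) - g_fun E s (p ^ Suc r) / of_nat p powr s)"
proof -
  have p0: "p > 1" using p prime_gt_1_nat by auto
  let ?f = "\<lambda>d. of_int (mobius d) * of_nat d powr s / of_nat (totient d) *
     (\<Sum>e | e dvd d. of_int (mobius e) / of_nat e powr s * g_fun E s (e * p ^ Suc r div d))"
  have mob: "mobius 1 = 1" "mobius p = -1"
    using mobius_prime_power[OF p, of 0] mobius_prime_power[OF p, of 1] by simp_all
  have dp: "{e. e dvd p} = {1, p}" using p by (auto simp: prime_nat_iff)
  have "G_fun E s (p ^ Suc r) = (\<Sum>d | d dvd p ^ Suc r. ?f d)" by (simp only: G_fun_def)
  also have "\<dots> = (\<Sum>d\<in>{1, p}. ?f d)"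
  proof (rule sum.mono_neutral_right)
    show "finite {d. d dvd p ^ Suc r}" using p0 by (intro finite_divisors_nat) auto
    show "\<forall>d\<in>{d. d dvd p ^ Suc r} - {1, p}. ?f d = 0"
    proof
      fix d assume d: "d \<in> {d. d dvd p ^ Suc r} - {1, p}"
      then obtain k where k: "d = p ^ k" using divides_primepow_nat[OF p] by blast
      with d have "k \<noteq> 0" "k \<noteq> 1" by auto
      then show "?f d = 0" unfolding k by (simp add: mobius_prime_power[OF p])
    qed
  qed auto
  also have "\<dots> = ?f 1 + ?f p" using p0 by simp
  also have "?f 1 = g_fun E s (p ^ Suc r)" using mob by simp
  also have "?f p = - (of_nat p powr s / (of_nat p - 1) *
      (g_fun E s (p ^ r) - g_fun E s (p ^ Suc r) / of_nat p powr s))"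
    unfolding dp using p0 mob p by (simp add: totient_prime of_nat_diff)
  finally show ?thesis by simp
qed

text \<open>As \<open>x * of_nat p powr z = 1 / of_nat p\<close>, adjoining \<open>-z\<close> to the
  denominator multiplies the series by \<open>lin_fps (1 / of_nat p)\<close>. A tail then becomes a
  tail of \<open>h\<close> minus 1/p times the preceding one, which is the combination formed by the
  Moebius sum in \<open>G_fun\<close>.\<close>

lemma G_fun_prime_power:
  fixes p :: nat and E :: "complex multiset" and z :: complex
  defines "x \<equiv> of_nat p powr (-(1 + z))"
  assumes p: "prime p" and E: "\<And>\<gamma>. \<gamma> \<in># E \<Longrightarrow> norm (x * of_nat p powr (-\<gamma>)) < 1"
  shows "(1 - 1 / of_nat p) * (x ^ r * G_fun E (1 + z) (p ^ r)) =
      (\<Prod>\<gamma>\<in>#E. 1 - x * of_nat p powr (-\<gamma>)) * (\<Sum>m. I_fps p x E {#-z#} $ (m + r))"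
proof -
  have p0: "p > 1" "of_nat p \<noteq> (0::complex)" "of_nat p - 1 \<noteq> (0::complex)"
    using prime_gt_1_nat[OF p] by auto
  define P where "P = (\<Prod>\<gamma>\<in>#E. 1 - x * of_nat p powr (-\<gamma>))"
  define h where "h = I_fps p x E {#}"
  define H where "H r = (\<Sum>m. h $ (m + r))" for r
  have sh: "summable (\<lambda>n. norm (h $ n))" unfolding h_def by (rule summable_norm_I_fps[OF E])
  then have sh': "summable (\<lambda>n. h $ n)" by (rule summable_norm_cancel)
  have "x * of_nat p powr z = 1 / of_nat p"
    using p0 by (simp add: x_def powr_minus divide_inverse flip: powr_add)
  then have fps: "I_fps p x E {#-z#} = lin_fps (1 / of_nat p) * h"
    by (simp add: I_fps_def h_def mult.commute)
  have g: "x ^ r * g_fun E (1 + z) (p ^ r) = P * H r" for r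
    using g_fun_prime_power(2)[OF p, of E "1 + z" r] E by (simp add: x_def P_def H_def h_def)
  show ?thesis
  proof (cases r)
    \<comment> \<open>There is no preceding tail here: the whole series is summed, and the linear
      factor contributes 1 - 1/p, matching \<open>G_fun\<close> being 1 at the argument 1.\<close>
    case 0
    have "G_fun E (1 + z) 1 = 1"
      using mobius_prime_power[OF p, of 0] by (simp add: G_fun_def g_fun_def)
    moreover have "(\<Sum>m. I_fps p x E {#-z#} $ m) = (1 - 1 / of_nat p) * H 0"
      unfolding fps using suminf_fps_mult[OF summable_norm_lin_fps sh, of "1 / of_nat p"]
        sums_unique[OF lin_fps_sums[of "1 / of_nat p"]] by (simp add: H_def)
    moreover have "P * H 0 = 1" using g[of 0] by (simp add: g_fun_def)
    ultimately show ?thesis using 0 by (simp add: P_def[symmetric] mult.left_commute)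
  next
    case (Suc k)
    have "(\<lambda>m. h $ (m + Suc k) - 1 / of_nat p * h $ (m + k)) sums (H (Suc k) - 1 / of_nat p * H k)"
      unfolding H_def 
      by (intro sums_diff sums_mult summable_sums summable_ignore_initial_segment sh')
    moreover have "I_fps p x E {#-z#} $ (m + Suc k) = h $ (m + Suc k) - 1 / of_nat p * h $ (m + k)" for m
      unfolding fps by (simp add: lin_fps_mult_nth)
    ultimately have S: "(\<Sum>m. I_fps p x E {#-z#} $ (m + r)) = H (Suc k) - 1 / of_nat p * H k"
      using Suc by (simp add: sums_iff)
    have ps: "x * of_nat p powr (1 + z) = 1"
      using p0 by (simp add: x_def flip: powr_add)
    have G: "(1 - 1 / of_nat p) * (x ^ r * G_fun E (1 + z) (p ^ r)) = P * H (Suc k) - 1 / of_nat p * (P * H k)"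
    proof -
      \<comment> \<open>Since \<open>y\<close> is inverse to \<open>x\<close>, the product
        \<open>x ^ Suc k * y\<close> collapses to \<open>x ^ k\<close>, the power that
        \<open>g\<close> requires for the value at \<open>p ^ k\<close>.\<close>
      define y where "y = of_nat p powr (1 + z)"
      have y: "x * y = 1" "y \<noteq> 0" using ps p0 by (auto simp: y_def)
      define u v where "u = g_fun E (1 + z) (p ^ Suc k)" and "v = g_fun E (1 + z) (p ^ k)"
      have "x ^ r * G_fun E (1 + z) (p ^ r) = x ^ Suc k * (u - y / (of_nat p - 1) * (v - u / y))"
        unfolding Suc G_fun_prime_power_Suc[OF p] u_def v_def y_def ..
      also have "y / (of_nat p - 1) * (v - u / y) = (y * v - u) / (of_nat p - 1)"
        using y(2) by (simp add: right_diff_distrib diff_divide_distrib)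
      also have "u - (y * v - u) / (of_nat p - 1) = (of_nat p * u - y * v) / (of_nat p - 1)"
        using p0(3) by (simp add: divide_simps) (simp add: algebra_simps)
      also have "x ^ Suc k * \<dots> = (of_nat p * (x ^ Suc k * u) - x * y * (x ^ k * v)) / (of_nat p - 1)"
        by (simp add: algebra_simps)
      also have "\<dots> = (of_nat p * (P * H (Suc k)) - P * H k) / (of_nat p - 1)"
        unfolding y(1) u_def v_def g[symmetric] by simp
      finally have eq: "x ^ r * G_fun E (1 + z) (p ^ r) = \<dots>" .
      have one: "1 - 1 / of_nat p = (of_nat p - 1) / (of_nat p :: complex)"
        using p0(2) by (simp add: diff_divide_distrib)
      have "(1 - 1 / of_nat p) * (x ^ r * G_fun E (1 + z) (p ^ r)) = (of_nat p * (P * H (Suc k)) - P * H k) / of_nat p"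
        unfolding eq one using p0(3) by simp
      then show ?thesis using p0(2) by (simp add: diff_divide_distrib)
    qed
    show ?thesis unfolding P_def[symmetric] G S by (simp add: right_diff_distrib)
  qed
qed

section \<open>The factor belonging to one index \<open>j\<close>\<close>

lemma I_fps_mset_shift:
  "I_fps p q (mset_shift s C) (mset_shift s D) = I_fps p (q * of_nat p powr (-s)) C D"
proof -
  have eq: "q * of_nat p powr (- (\<gamma> + s)) = q * of_nat p powr (-s) * of_nat p powr (-\<gamma>)" for \<gamma>
  proof -
    have "- (\<gamma> + s) = -s + -\<gamma>" by simp
    then show ?thesis by (simp only: powr_add mult.assoc)
  qed
  show ?thesis
    by (simp only: I_fps_def mset_shift_def image_mset.compositionality o_def eq)
qed

text \<open>The power of \<open>p\<close> in the summand equals \<open>v ^ d\<close> times exactly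
  the powers of \<open>x\<close> and \<open>y\<close> that turn the two \<open>G_fun\<close> values
  into tails. Each conversion costs a factor 1 - 1/p. The values \<open>q = 0\<close> and
  \<open>q = 1\<close> supply the two terms of the difference.\<close>

lemma d_term_eq:
  fixes p :: nat and A B :: "complex multiset" and \<xi> \<eta> z w :: complex
  defines "x \<equiv> of_nat p powr (-(1 + z))" and "y \<equiv> of_nat p powr (-(1 + w))"
    and "v \<equiv> of_nat p powr (1 + z + w - \<xi> - \<eta>)"
  defines "S \<equiv> \<lambda>r. \<Sum>m. I_fps p x A {#-z#} $ (m + r)" and "T \<equiv> \<lambda>r. \<Sum>n. I_fps p y B {#-w#} $ (n + r)"
  assumes p: "prime p"
    and A: "\<And>\<alpha>. \<alpha> \<in># A \<Longrightarrow> norm (x * of_nat p powr (-\<alpha>)) < 1"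
    and B: "\<And>\<beta>. \<beta> \<in># B \<Longrightarrow> norm (y * of_nat p powr (-\<beta>)) < 1"
  shows "d_term p \<xi> \<eta> A B z w M N d =
    inverse ((1 - 1 / of_nat p) ^ 2) * (\<Prod>\<alpha>\<in>#A. 1 - x * of_nat p powr (-\<alpha>)) *
      (\<Prod>\<beta>\<in>#B. 1 - y * of_nat p powr (-\<beta>)) *
      (v ^ d * (S (d - N) * T (d - M) - S (Suc d - N) * T (Suc d - M)))"
proof -
  have p1: "p > 1" "p > 0" using prime_gt_1_nat[OF p] by auto
  define c :: complex where "c = 1 - 1 / of_nat p"
  define PA where "PA = (\<Prod>\<alpha>\<in>#A. 1 - x * of_nat p powr (-\<alpha>))"
  define PB where "PB = (\<Prod>\<beta>\<in>#B. 1 - y * of_nat p powr (-\<beta>))"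
  have c0: "c \<noteq> 0" using p1 by (simp add: c_def)
  have G: "x ^ r * G_fun A (1 + z) (p ^ r) = PA * S r / c" "y ^ r * G_fun B (1 + w) (p ^ r) = PB * T r / c" for r
    using G_fun_prime_power[OF p, of A z r] G_fun_prime_power[OF p, of B w r] A B c0
    unfolding c_def[symmetric] PA_def PB_def S_def T_def x_def y_def
    by (simp_all add: field_simps)
  have summand: "of_nat p powr (of_nat (min (q + d) N) * (1 + z) + of_nat (min (q + d) M) * (1 + w)
           - of_nat q * (2 + z + w) - of_nat d * (1 + \<xi> + \<eta>)) *
         G_fun A (1 + z) (p ^ (q + d - min (q + d) N)) * G_fun B (1 + w) (p ^ (q + d - min (q + d) M))
       = inverse (c ^ 2) * PA * PB * (v ^ d * (S (q + d - N) * T (q + d - M)))" (is "?e * ?G * ?H = _") for q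
  proof -
    have nat_diff: "of_nat (q + d - min (q + d) L) = (of_nat (q + d) - of_nat (min (q + d) L) :: complex)" for L
      by (rule of_nat_diff) simp
    have "v ^ d * x ^ (q + d - min (q + d) N) * y ^ (q + d - min (q + d) M) = of_nat p powr
       (of_nat d * (1 + z + w - \<xi> - \<eta>) + of_nat (q + d - min (q + d) N) * (-(1 + z))
         + of_nat (q + d - min (q + d) M) * (-(1 + w)))"
      unfolding v_def x_def y_def of_nat_powr_power[OF p1(2)] powr_add ..
    also have "\<dots> = ?e"
      unfolding nat_diff of_nat_add by (rule arg_cong[where f = "\<lambda>s. of_nat p powr s"]) (simp add: algebra_simps)
    finally have e: "?e = v ^ d * x ^ (q + d - min (q + d) N) * y ^ (q + d - min (q + d) M)" by (rule sym)
    have "?e * ?G * ?H = v ^ d * (x ^ (q + d - min (q + d) N) * ?G) * (y ^ (q + d - min (q + d) M) * ?H)"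
      unfolding e by (simp only: mult_ac)
    also have "\<dots> = v ^ d * (PA * S (q + d - min (q + d) N) / c) * (PB * T (q + d - min (q + d) M) / c)"
      unfolding G ..
    finally have "?e * ?G * ?H = \<dots>" .
    moreover have "q + d - min (q + d) L = q + d - L" for L by simp
    ultimately show ?thesis by (simp add: divide_inverse power2_eq_square mult_ac)
  qed
  have "{0..1} = {0, 1::nat}" by auto
  then have "d_term p \<xi> \<eta> A B z w M N d = inverse (c ^ 2) * PA * PB * (v ^ d * (S (0 + d - N) * T (0 + d - M))) -
      inverse (c ^ 2) * PA * PB * (v ^ d * (S (1 + d - N) * T (1 + d - M)))"
    unfolding summand[symmetric] d_term_def by simp
  then show ?thesis by (simp add: c_def PA_def PB_def right_diff_distrib)
qed

text \<open>Choosing \<open>Y\<close> as p^(-1/2) shares the weight 1/p^m equally between the two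
  coefficient sequences. The hypotheses on real parts put every geometric ratio that occurs inside
  the unit disc.\<close>

lemma MN_factor_eq:
  fixes p :: nat and A B :: "complex multiset" and \<xi> \<eta> z w :: complex and M N :: nat
  defines "Y \<equiv> of_nat p powr (- (1 / 2))"
  defines "F \<equiv> I_fps p Y (mset_shift (\<xi> + \<eta>) A + {#w#}) (mset_shift (\<xi> + \<eta>) {#-z#})"
    and "E \<equiv> I_fps p Y (B + {#z - \<xi> - \<eta>#}) {#-w#}"
  assumes p: "prime p" and MN: "min M N = 0"
    and A: "\<And>\<alpha>. \<alpha> \<in># A \<Longrightarrow> - 1 < Re z + Re \<alpha>" "\<And>\<alpha>. \<alpha> \<in># A \<Longrightarrow> - (1 / 2) < Re \<xi> + Re \<eta> + Re \<alpha>"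
    and B: "\<And>\<beta>. \<beta> \<in># B \<Longrightarrow> - 1 < Re w + Re \<beta>" "\<And>\<beta>. \<beta> \<in># B \<Longrightarrow> - (1 / 2) < Re \<beta>"
    and w: "- (1 / 2) < Re w" and z: "Re \<xi> + Re \<eta> - Re z < 1 / 2"
  shows "summable (d_term p \<xi> \<eta> A B z w M N)"
    and "MN_factor p \<xi> \<eta> A B z w M N = of_nat p powr (\<eta> * (of_nat M - of_nat N)) *
      (inverse ((1 - 1 / of_nat p) ^ 2) *
        ((1 - 1 / of_nat p powr (1 + w + z - \<xi> - \<eta>)) *
         (\<Prod>\<alpha>\<in>#A. 1 - 1 / of_nat p powr (1 + z + \<alpha>)) *
         (\<Prod>\<beta>\<in>#B. 1 - 1 / of_nat p powr (1 + w + \<beta>)))) *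
      (\<Sum>i. F $ (M + i) * E $ (N + i))"
proof -
  have p1: "p > 1" "p > 0" using prime_gt_1_nat[OF p] by auto
  define x where "x = of_nat p powr (-(1 + z))"
  define y where "y = of_nat p powr (-(1 + w))"
  define v where "v = of_nat p powr (1 + z + w - \<xi> - \<eta>)"
  \<comment> \<open>\<open>X\<close> is the scale of the series for \<open>A\<close> once the shift
    by \<open>\<xi> + \<eta>\<close> is absorbed. \<open>U\<close> and \<open>V\<close> are the
    ratios contributed by the extra elements \<open>w\<close> and
    \<open>z - \<xi> - \<eta>\<close>.\<close>
  define X where "X = Y * of_nat p powr (- (\<xi> + \<eta>))"
  define U where "U = Y * of_nat p powr (-w)"
  define V where "V = Y * of_nat p powr (- (z - \<xi> - \<eta>))"
  note defs = x_def y_def v_def X_def Y_def U_def V_def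
  have rel: "x * v * U = X" "y * v * V = Y" "U * V * v = 1"
    using p1 unfolding defs powr_add[symmetric] by (simp_all add: algebra_simps)
  have UV: "norm U < 1" "norm V < 1"
    using w z p1 unfolding defs powr_add[symmetric] by (auto intro!: norm_of_nat_powr_less_1)
  define a where "a m = I_coeff A {#-z#} (p ^ m)" for m
  define b where "b n = I_coeff B {#-w#} (p ^ n)" for n
  have a: "a m * t ^ m = I_fps p t A {#-z#} $ m" for m t
    by (simp add: a_def I_fps_nth[OF p])
  have b: "b m * t ^ m = I_fps p t B {#-w#} $ m" for m t
    by (simp add: b_def I_fps_nth[OF p])
  have xA: "norm (x * of_nat p powr (-\<alpha>)) < 1" if "\<alpha> \<in># A" for \<alpha>
    using A(1)[OF that] p1 unfolding defs powr_add[symmetric] by (auto intro!: norm_of_nat_powr_less_1)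
  have yB: "norm (y * of_nat p powr (-\<beta>)) < 1" if "\<beta> \<in># B" for \<beta>
    using B(1)[OF that] p1 unfolding defs powr_add[symmetric] by (auto intro!: norm_of_nat_powr_less_1)
  have XA: "norm (X * of_nat p powr (-\<alpha>)) < 1" if "\<alpha> \<in># A" for \<alpha>
    using A(2)[OF that] p1 unfolding defs powr_add[symmetric] by (auto intro!: norm_of_nat_powr_less_1)
  have YB: "norm (Y * of_nat p powr (-\<beta>)) < 1" if "\<beta> \<in># B" for \<beta>
    using B(2)[OF that] p1 unfolding defs powr_add[symmetric] by (auto intro!: norm_of_nat_powr_less_1)
  have F: "F = Abs_fps (\<lambda>m. a m * X ^ m) * geom_fps U"
  proof -
    have "F = I_fps p Y (mset_shift (\<xi> + \<eta>) A) (mset_shift (\<xi> + \<eta>) {#-z#}) * I_fps p Y {#w#} {#}"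
      unfolding F_def by (simp flip: I_fps_add)
    also have "\<dots> = I_fps p X A {#-z#} * geom_fps U"
      unfolding I_fps_mset_shift X_def[symmetric] by (simp add: I_fps_def[of _ _ "{#w#}"] U_def)
    finally show ?thesis unfolding a fps_nth_inverse .
  qed
  have E: "E = Abs_fps (\<lambda>n. b n * Y ^ n) * geom_fps V"
  proof -
    have "E = I_fps p Y B {#-w#} * I_fps p Y {#z - \<xi> - \<eta>#} {#}"
      unfolding E_def by (simp flip: I_fps_add)
    also have "\<dots> = I_fps p Y B {#-w#} * geom_fps V"
      by (simp add: I_fps_def[of _ _ "{#z - \<xi> - \<eta>#}"] V_def)
    finally show ?thesis unfolding b fps_nth_inverse .
  qed
  define Q where "Q = inverse ((1 - 1 / of_nat p) ^ 2) * (\<Prod>\<alpha>\<in>#A. 1 - x * of_nat p powr (-\<alpha>)) *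
      (\<Prod>\<beta>\<in>#B. 1 - y * of_nat p powr (-\<beta>))"
  define D where "D d = v ^ d * ((\<Sum>m. a (m + (d - N)) * x ^ (m + (d - N))) * (\<Sum>n. b (n + (d - M)) * y ^ (n + (d - M)))
       - (\<Sum>m. a (m + (Suc d - N)) * x ^ (m + (Suc d - N))) * (\<Sum>n. b (n + (Suc d - M)) * y ^ (n + (Suc d - M))))" for d
  have dt: "d_term p \<xi> \<eta> A B z w M N d = Q * D d" for d
    unfolding Q_def D_def a b unfolding x_def y_def v_def
    by (rule d_term_eq[OF p xA[unfolded x_def] yB[unfolded y_def]])
  have "(\<lambda>d. U ^ M * V ^ N * D d) sums ((1 - U * V) * (\<Sum>i. F $ (M + i) * E $ (N + i)))"
    unfolding D_def F E
    by (rule sum_by_min_eq_sum_by_max[OF MN rel UV])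
       (simp_all add: a b summable_norm_I_fps xA yB XA YB)
  then have sums: "(\<lambda>d. U ^ M * V ^ N * d_term p \<xi> \<eta> A B z w M N d) sums
      (Q * ((1 - U * V) * (\<Sum>i. F $ (M + i) * E $ (N + i))))"
    unfolding dt by (subst mult.left_commute) (rule sums_mult)
  \<comment> \<open>A nonzero constant can be divided out, which yields convergence of the series of
    \<open>d_term\<close> itself.\<close>
  have UV0: "U ^ M * V ^ N \<noteq> 0" using rel(3) by auto
  show S: "summable (d_term p \<xi> \<eta> A B z w M N)"
    by (rule summable_mult_D[OF sums_summable[OF sums] UV0])
  \<comment> \<open>The prefactor is split into \<open>U ^ M * V ^ N\<close> and a remainder that
    depends on \<open>M\<close> and \<open>N\<close> only through their difference, so that it can
    cancel over all \<open>j\<close>.\<close>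
  have "of_nat N * (- 1 / 2 + \<xi> - z) + of_nat M * (- 1 / 2 + \<eta> - w) =
      \<eta> * (of_nat M - of_nat N) + (of_nat M * (- (1 / 2) + - w) + of_nat N * (- (1 / 2) + - (z - \<xi> - \<eta>)))"
    by (simp add: algebra_simps)
  then have "of_nat p powr (of_nat N * (- 1 / 2 + \<xi> - z) + of_nat M * (- 1 / 2 + \<eta> - w)) =
      of_nat p powr (\<eta> * (of_nat M - of_nat N)) * (U ^ M * V ^ N)"
    unfolding U_def V_def Y_def by (simp only: powr_add of_nat_powr_power[OF p1(2)] power_mult_distrib distrib_left)
  then have "MN_factor p \<xi> \<eta> A B z w M N = of_nat p powr (\<eta> * (of_nat M - of_nat N)) *
      (U ^ M * V ^ N * (\<Sum>d. d_term p \<xi> \<eta> A B z w M N d))"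
    by (simp add: MN_factor_def)
  also have "U ^ M * V ^ N * (\<Sum>d. d_term p \<xi> \<eta> A B z w M N d) = Q * ((1 - U * V) * (\<Sum>i. F $ (M + i) * E $ (N + i)))"
    using sums_unique[OF sums] suminf_mult[OF S] by simp
  also have "U * V = 1 / of_nat p powr (1 + w + z - \<xi> - \<eta>)"
  proof -
    have "of_nat p powr (1 + w + z - \<xi> - \<eta>) = v" by (simp add: v_def add_ac)
    then show ?thesis using rel(3) by (metis divide_self mult_zero_right nonzero_divide_eq_eq zero_neq_one)
  qed
  also have "Q = inverse ((1 - 1 / of_nat p) ^ 2) * ((\<Prod>\<alpha>\<in>#A. 1 - 1 / of_nat p powr (1 + z + \<alpha>)) *
         (\<Prod>\<beta>\<in>#B. 1 - 1 / of_nat p powr (1 + w + \<beta>)))"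
  proof -
    have eq: "of_nat p powr (-(1 + s)) * of_nat p powr (-t) = 1 / of_nat p powr (1 + s + t)" for s t :: complex
    proof -
      have "of_nat p powr (-(1 + s)) * of_nat p powr (-t) = of_nat p powr (- (1 + s + t))"
        unfolding powr_add[symmetric] by (simp add: algebra_simps)
      then show ?thesis by (simp only: powr_minus inverse_eq_divide)
    qed
    show ?thesis unfolding Q_def x_def y_def eq by (simp only: mult.assoc)
  qed
  finally show "MN_factor p \<xi> \<eta> A B z w M N = of_nat p powr (\<eta> * (of_nat M - of_nat N)) *
      (inverse ((1 - 1 / of_nat p) ^ 2) *
        ((1 - 1 / of_nat p powr (1 + w + z - \<xi> - \<eta>)) *
         (\<Prod>\<alpha>\<in>#A. 1 - 1 / of_nat p powr (1 + z + \<alpha>)) *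
         (\<Prod>\<beta>\<in>#B. 1 - 1 / of_nat p powr (1 + w + \<beta>)))) *
      (\<Sum>i. F $ (M + i) * E $ (N + i))"
    by (simp add: mult_ac)
qed

section \<open>The identity\<close>

lemma image_mset_mset_set_eq_sum: "finite J \<Longrightarrow> image_mset f (mset_set J) = (\<Sum>j\<in>J. {#f j#})"
  by (induction J rule: finite_induct) auto

lemma mset_shift_sum: "finite J \<Longrightarrow> mset_shift s (\<Sum>j\<in>J. C j) = (\<Sum>j\<in>J. mset_shift s (C j))"
  by (induction J rule: finite_induct) (auto simp: mset_shift_def)

text \<open>"Arbitrarily small" is rendered by an absolute bound below which every positive
  \<epsilon> is admissible. Convergence is part of the conclusion because infinite sums in the logic
  are total and take default values when they diverge.\<close>

theorem theorem4p4:
  shows "\<exists>\<epsilon>\<^sub>0>0. \<forall>(\<epsilon>::real) (l::nat) (p::nat) (\<xi>::complex) (\<eta>::complex)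
      (A::complex multiset) (B::complex multiset) (Z::complex multiset) (W::complex multiset)
      (As::nat \<Rightarrow> complex multiset) (Bs::nat \<Rightarrow> complex multiset)
      (z::nat \<Rightarrow> complex) (w::nat \<Rightarrow> complex).
    0 < \<epsilon> \<longrightarrow> \<epsilon> < \<epsilon>\<^sub>0 \<longrightarrow> l > 0 \<longrightarrow> prime p \<longrightarrow>
    Z = image_mset z (mset_set {1..l}) \<longrightarrow> W = image_mset w (mset_set {1..l}) \<longrightarrow>
    A = (\<Sum>j=1..l. As j) \<longrightarrow> B = (\<Sum>j=1..l. Bs j) \<longrightarrow>
    Re \<xi> = 2 * \<epsilon> \<longrightarrow> Re \<eta> = 2 * \<epsilon> \<longrightarrow> (\<forall>\<gamma>\<in>#A + B + Z + W. \<bar>Re \<gamma>\<bar> \<le> \<epsilon>) \<longrightarrow>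
    \<comment> \<open>convergence of all the series involved\<close>
    (\<forall>j\<in>{1..l}. \<forall>k.
       summable (\<lambda>m. tau (As j) (p ^ (m + k)) * of_nat p powr (- (of_nat m * (1 + z j)))) \<and>
       summable (\<lambda>m. tau (Bs j) (p ^ (m + k)) * of_nat p powr (- (of_nat m * (1 + w j))))) \<and>
    (\<forall>j\<in>{1..l}. \<forall>M N. min M N = 0 \<longrightarrow>
       summable (d_term p \<xi> \<eta> (As j) (Bs j) (z j) (w j) M N)) \<and>
    (\<lambda>(M, N). \<Prod>j=1..l. MN_factor p \<xi> \<eta> (As j) (Bs j) (z j) (w j) (M j) (N j))
      summable_on MN_index l \<and>
    summable (\<lambda>m. I_coeff (mset_shift (\<xi> + \<eta>) A + W) (mset_shift (\<xi> + \<eta>) (mset_neg Z)) (p ^ m) *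
                  I_coeff (B + mset_shift (- \<xi> - \<eta>) Z) (mset_neg W) (p ^ m) / of_nat p ^ m) \<and>
    \<comment> \<open>the identity\<close>
    (\<Sum>\<^sub>\<infinity>(M, N)\<in>MN_index l.
       \<Prod>j=1..l. MN_factor p \<xi> \<eta> (As j) (Bs j) (z j) (w j) (M j) (N j)) =
    inverse ((1 - 1 / of_nat p) ^ (2 * l)) *
    (\<Prod>j=1..l. (1 - 1 / of_nat p powr (1 + w j + z j - \<xi> - \<eta>)) *
       (\<Prod>\<alpha>\<in>#As j. 1 - 1 / of_nat p powr (1 + z j + \<alpha>)) *
       (\<Prod>\<beta>\<in>#Bs j. 1 - 1 / of_nat p powr (1 + w j + \<beta>))) *
    (\<Sum>m. I_coeff (mset_shift (\<xi> + \<eta>) A + W) (mset_shift (\<xi> + \<eta>) (mset_neg Z)) (p ^ m) *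
          I_coeff (B + mset_shift (- \<xi> - \<eta>) Z) (mset_neg W) (p ^ m) / of_nat p ^ m)"
\<comment> \<open>The tightest requirement is
  \<open>Re \<xi> + Re \<eta> - Re (z j) < 1 / 2\<close>, whose left side is at most 5 \<epsilon>.
  The bound 1/20 meets it with room to spare.\<close>
proof (intro exI[of _ "1 / 20"] conjI[of "(0::real) < 1 / 20"] allI impI, goal_cases)
  case 1
  show ?case by simp
next
  case (2 \<epsilon> l p \<xi> \<eta> A B Z W As Bs z w)
  then have \<epsilon>: "0 < \<epsilon>" "\<epsilon> < 1 / 20" and p: "prime p"
    and Z: "Z = image_mset z (mset_set {1..l})" and W: "W = image_mset w (mset_set {1..l})"
    and A: "A = (\<Sum>j=1..l. As j)" and B: "B = (\<Sum>j=1..l. Bs j)"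
    and re: "Re \<xi> = 2 * \<epsilon>" "Re \<eta> = 2 * \<epsilon>"
    and bound: "\<And>\<gamma>. \<gamma> \<in># A + B + Z + W \<Longrightarrow> \<bar>Re \<gamma>\<bar> \<le> \<epsilon>"
    by blast+
  have p1: "p > 1" using prime_gt_1_nat[OF p] .
  have bA: "\<bar>Re \<alpha>\<bar> \<le> \<epsilon>" if "j \<in> {1..l}" "\<alpha> \<in># As j" for j \<alpha>
    by (rule bound) (use that in \<open>auto simp: A set_mset_sum\<close>)
  have bB: "\<bar>Re \<beta>\<bar> \<le> \<epsilon>" if "j \<in> {1..l}" "\<beta> \<in># Bs j" for j \<beta>
    by (rule bound) (use that in \<open>auto simp: B set_mset_sum\<close>)
  have bz: "\<bar>Re (z j)\<bar> \<le> \<epsilon>" and bw: "\<bar>Re (w j)\<bar> \<le> \<epsilon>" if "j \<in> {1..l}" for j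
    by (rule bound, use that in \<open>auto simp: Z W\<close>)+
  define Y :: complex where "Y = of_nat p powr (- (1 / 2))"
  define F where "F j = I_fps p Y (mset_shift (\<xi> + \<eta>) (As j) + {#w j#}) (mset_shift (\<xi> + \<eta>) {#-z j#})" for j
  define E where "E j = I_fps p Y (Bs j + {#z j - \<xi> - \<eta>#}) {#-w j#}" for j
  define c where "c j = (1 - 1 / of_nat p powr (1 + w j + z j - \<xi> - \<eta>)) *
       (\<Prod>\<alpha>\<in>#As j. 1 - 1 / of_nat p powr (1 + z j + \<alpha>)) *
       (\<Prod>\<beta>\<in>#Bs j. 1 - 1 / of_nat p powr (1 + w j + \<beta>))" for j
  define C where "C = inverse ((1 - 1 / of_nat p) ^ (2 * l)) * (\<Prod>j=1..l. c j)"

  have tau: "summable (\<lambda>m. tau (As j) (p ^ (m + k)) * of_nat p powr (- (of_nat m * (1 + z j))))"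
    "summable (\<lambda>m. tau (Bs j) (p ^ (m + k)) * of_nat p powr (- (of_nat m * (1 + w j))))"
    if j: "j \<in> {1..l}" for j k
  proof -
    have *: "norm (of_nat p powr (- (1 + s)) * of_nat p powr (- t)) < 1" if "\<bar>Re s\<bar> \<le> \<epsilon>" "\<bar>Re t\<bar> \<le> \<epsilon>" for s t
      unfolding powr_add[symmetric] using that \<epsilon> p1 by (intro norm_of_nat_powr_less_1) auto
    show "summable (\<lambda>m. tau (As j) (p ^ (m + k)) * of_nat p powr (- (of_nat m * (1 + z j))))"
      using bA[OF j] bz[OF j] by (intro g_fun_prime_power(1)[OF p] *)
    show "summable (\<lambda>m. tau (Bs j) (p ^ (m + k)) * of_nat p powr (- (of_nat m * (1 + w j))))"
      using bB[OF j] bw[OF j] by (intro g_fun_prime_power(1)[OF p] *)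
  qed
  have local: "summable (d_term p \<xi> \<eta> (As j) (Bs j) (z j) (w j) M N)"
    "MN_factor p \<xi> \<eta> (As j) (Bs j) (z j) (w j) M N = of_nat p powr (\<eta> * (of_nat M - of_nat N)) *
      (inverse ((1 - 1 / of_nat p) ^ 2) * c j) * (\<Sum>i. F j $ (M + i) * E j $ (N + i))"
    if j: "j \<in> {1..l}" and "min M N = 0" for j M N
  proof -
    have "- 1 < Re (z j) + Re \<alpha>" "- (1 / 2) < Re \<xi> + Re \<eta> + Re \<alpha>" if "\<alpha> \<in># As j" for \<alpha>
      using bA[OF j that] bz[OF j] re \<epsilon> by linarith+
    moreover have "- 1 < Re (w j) + Re \<beta>" "- (1 / 2) < Re \<beta>" if "\<beta> \<in># Bs j" for \<beta>
      using bB[OF j that] bw[OF j] re \<epsilon> by linarith+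
    moreover have "- (1 / 2) < Re (w j)" "Re \<xi> + Re \<eta> - Re (z j) < 1 / 2"
      using bw[OF j] bz[OF j] re \<epsilon> by linarith+
    ultimately show "summable (d_term p \<xi> \<eta> (As j) (Bs j) (z j) (w j) M N)"
      "MN_factor p \<xi> \<eta> (As j) (Bs j) (z j) (w j) M N = of_nat p powr (\<eta> * (of_nat M - of_nat N)) *
      (inverse ((1 - 1 / of_nat p) ^ 2) * c j) * (\<Sum>i. F j $ (M + i) * E j $ (N + i))"
      unfolding c_def F_def E_def Y_def using MN_factor_eq[OF p \<open>min M N = 0\<close>] by blast+
  qed

  have FE: "summable (\<lambda>n. norm (F j $ n))" "summable (\<lambda>n. norm (E j $ n))" if j: "j \<in> {1..l}" for j
  proof -
    show "summable (\<lambda>n. norm (F j $ n))" unfolding F_def Y_def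
    proof (rule summable_norm_I_fps, unfold powr_add[symmetric], rule norm_of_nat_powr_less_1[OF p1])
      fix \<gamma> assume "\<gamma> \<in># mset_shift (\<xi> + \<eta>) (As j) + {#w j#}"
      then show "Re (- (1 / 2) + - \<gamma>) < 0"
        using bA[OF j] bw[OF j] re \<epsilon> by (fastforce simp: mset_shift_def)
    qed
    show "summable (\<lambda>n. norm (E j $ n))" unfolding E_def Y_def
    proof (rule summable_norm_I_fps, unfold powr_add[symmetric], rule norm_of_nat_powr_less_1[OF p1])
      fix \<gamma> assume "\<gamma> \<in># Bs j + {#z j - \<xi> - \<eta>#}"
      then show "Re (- (1 / 2) + - \<gamma>) < 0"
        using bB[OF j] bz[OF j] re \<epsilon> by fastforce
    qed
  qed
  obtain T where T:
    "((\<lambda>(M, N). \<Prod>j=1..l. \<Sum>i. F j $ (M j + i) * E j $ (N j + i)) has_sum T) (MN_index l)"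
    "(\<lambda>m. (\<Prod>j=1..l. F j) $ m * (\<Prod>j=1..l. E j) $ m) sums T"
    by (rule has_sum_MN_index[of l F E, OF FE])

  have prod: "(\<Prod>j=1..l. MN_factor p \<xi> \<eta> (As j) (Bs j) (z j) (w j) (M j) (N j)) =
      C * (\<Prod>j=1..l. \<Sum>i. F j $ (M j + i) * E j $ (N j + i))" if "(M, N) \<in> MN_index l" for M N
  proof -
    have *: "(\<Sum>j=1..l. M j) = (\<Sum>j=1..l. N j)" "\<And>j. j \<in> {1..l} \<Longrightarrow> min (M j) (N j) = 0"
      using that by (auto simp: MN_index_def)
    \<comment> \<open>The leftover powers of \<open>p\<close> multiply to \<open>p\<close> raised to
      \<eta> times the difference of the totals, which is zero on \<open>MN_index l\<close>.\<close>
    have "(\<Sum>j=1..l. \<eta> * (of_nat (M j) - of_nat (N j))) = \<eta> * (of_nat (\<Sum>j=1..l. M j) - of_nat (\<Sum>j=1..l. N j))"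
      by (simp add: sum_subtractf flip: sum_distrib_left)
    also have "\<dots> = 0" unfolding *(1) by simp
    finally have "(\<Prod>j=1..l. of_nat p powr (\<eta> * (of_nat (M j) - of_nat (N j)))) = (1::complex)"
      using p1 by (simp flip: powr_sum)
    moreover have "(\<Prod>j=1..l. inverse ((1 - 1 / of_nat p) ^ 2) * c j) = C"
      by (simp add: C_def prod.distrib power_mult power_inverse)
    moreover have "(\<Prod>j=1..l. MN_factor p \<xi> \<eta> (As j) (Bs j) (z j) (w j) (M j) (N j)) =
      (\<Prod>j=1..l. of_nat p powr (\<eta> * (of_nat (M j) - of_nat (N j))) *
      (inverse ((1 - 1 / of_nat p) ^ 2) * c j) * (\<Sum>i. F j $ (M j + i) * E j $ (N j + i)))"
      using * by (intro prod.cong refl local) auto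
    ultimately show ?thesis by (simp only: prod.distrib mult_1_left)
  qed
  have MN: "((\<lambda>(M, N). \<Prod>j=1..l. MN_factor p \<xi> \<eta> (As j) (Bs j) (z j) (w j) (M j) (N j)) has_sum C * T) (MN_index l)"
    using has_sum_cmult_right[OF T(1), of C]
    by (rule has_sum_cong[THEN iffD1, rotated]) (auto simp: prod simp del: One_nat_def)

  have YY: "Y * Y = 1 / of_nat p"
  proof -
    have "Y * Y = of_nat p powr (- (1 / 2) + - (1 / 2))" unfolding Y_def by (simp only: powr_add)
    also have "- (1 / 2) + - (1 / 2) = (- 1 :: complex)" by simp
    also have "of_nat p powr (- 1) = (1 / of_nat p powr 1 :: complex)" by (rule powr_minus_divide)
    finally show ?thesis by simp
  qed
  have Z': "mset_neg Z = (\<Sum>j=1..l. {#-z j#})" "mset_neg W = (\<Sum>j=1..l. {#-w j#})"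
    "W = (\<Sum>j=1..l. {#w j#})" "mset_shift (- \<xi> - \<eta>) Z = (\<Sum>j=1..l. {#z j - \<xi> - \<eta>#})"
    by (simp_all add: Z W mset_neg_def mset_shift_def image_mset.compositionality o_def
        algebra_simps flip: image_mset_mset_set_eq_sum)
  \<comment> \<open>Euler factors multiply under multiset union, so the product over
    \<open>j\<close> reassembles the partitions into the full multisets.\<close>
  have prodF: "(\<Prod>j=1..l. F j) = I_fps p Y (mset_shift (\<xi> + \<eta>) A + W) (mset_shift (\<xi> + \<eta>) (mset_neg Z))"
    unfolding F_def I_fps_sum[OF finite_atLeastAtMost] A Z' by (simp only: mset_shift_sum sum.distrib finite_atLeastAtMost)
  have prodE: "(\<Prod>j=1..l. E j) = I_fps p Y (B + mset_shift (- \<xi> - \<eta>) Z) (mset_neg W)"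
    unfolding E_def I_fps_sum[OF finite_atLeastAtMost] B Z'(2,4) by (simp only: sum.distrib)
  have "(\<Prod>j=1..l. F j) $ m * (\<Prod>j=1..l. E j) $ m =
      I_coeff (mset_shift (\<xi> + \<eta>) A + W) (mset_shift (\<xi> + \<eta>) (mset_neg Z)) (p ^ m) *
      I_coeff (B + mset_shift (- \<xi> - \<eta>) Z) (mset_neg W) (p ^ m) / of_nat p ^ m" (is "_ = ?I m") for m
  proof -
    \<comment> \<open>The two scales combine to the weight 1/p^m in the series on the right-hand
      side.\<close>
    have "Y ^ m * Y ^ m = 1 / of_nat p ^ m"
      using YY by (simp add: power_one_over flip: power_mult_distrib)
    moreover have "Y ^ m * i * (Y ^ m * k) = Y ^ m * Y ^ m * (i * k)" for i k
      by (simp add: mult_ac)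
    ultimately show ?thesis unfolding prodF prodE I_fps_nth[OF p] by simp
  qed
  with T(2) have sums: "?I sums T" by (simp only:)

  show ?case
  proof (intro conjI ballI allI impI, goal_cases)
    case (1 j k)
    then show ?case by (rule tau(1))
  next
    case (2 j k)
    then show ?case by (rule tau(2))
  next
    case (3 j M N)
    then show ?case by (rule local(1))
  next
    case 4
    show ?case using MN by (rule has_sum_imp_summable)
  next
    case 5
    show ?case using sums by (rule sums_summable)
  next
    case 6
    show ?case
      unfolding infsumI[OF MN] sums_unique[OF sums, symmetric] C_def c_def ..
  qed
qed

end
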